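(* Let $\mathcal{E},\mathcal{E}_*$ be Hilbert spaces, let $\Theta \in H^\infty_{\mathcal{B}(\mathcal{E}, \mathcal{E}_* )}(\mathbb{D})$ be an inner function and let $A \in \mathcal{B}(\mathcal{E}_* )$. Then $\mathcal{S} = M_{\Theta} H^2_{\mathcal{E}}(\mathbb{D}) \subseteq H^2_{\mathcal{E}_*}(\mathbb{D})$ is invariant under the Toeplitz operator with analytic polynomial symbol $A + A^*z$ if and only if there exists an operator $B \in \mathcal{B}(\mathcal{E})$ such that $$(A + A^* z) \Theta(z) = \Theta(z) (B + B^* z) \qquad (z \in \mathbb{D}).$$ Moreover, when such an operator $B$ exists it is unique (up to unitary equivalence).
   Context: All Hilbert spaces are complex and separable. $\mathbb{D}$ is the open unit disc and $H^2_{\mathcal{E}}(\mathbb{D})$ is the $\mathcal{E}$-valued Hardy space. A function $\Theta \in H^\infty_{\mathcal{B}(\mathcal{E},\mathcal{E}_* )}(\mathbb{D})$ is inner if its boundary values are isometries almost everywhere on the circle (equivalently, the multiplication operator $M_\Theta: H^2_{\mathcal{E}}(\mathbb{D})\to H^2_{\mathcal{E}_*}(\mathbb{D})$, $(M_\Theta f)(z)=\Theta(z)f(z)$, is an isometry). The Toeplitz operator with analytic symbol $A+A^*z$ is the multiplication operator $f(z)\mapsto (A+A^*z)f(z)$ on $H^2_{\mathcal{E}_*}(\mathbb{D})$. *)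

theory Defs
  imports "HOL-Analysis.Analysis"
begin

class complex_vector = real_vector +
  fixes scaleC :: "complex \<Rightarrow> 'a \<Rightarrow> 'a"  (infixr \<open>*\<^sub>C\<close> 75)
  assumes scaleC_add_right: "c *\<^sub>C (x + y) = c *\<^sub>C x + c *\<^sub>C y"
    and scaleC_add_left: "(c + d) *\<^sub>C x = c *\<^sub>C x + d *\<^sub>C x"
    and scaleC_scaleC: "c *\<^sub>C d *\<^sub>C x = (c * d) *\<^sub>C x"
    and scaleR_scaleC: "r *\<^sub>R x = complex_of_real r *\<^sub>C x"

text \<open>The inner product is linear in its first argument. The axiom \<open>cinner_self\<close> expresses
  positive definiteness together with the fact that the norm is the induced one.\<close>

class complex_inner = complex_vector + real_normed_vector +
  fixes cinner :: "'a \<Rightarrow> 'a \<Rightarrow> complex"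
  assumes cinner_commute: "cinner x y = cnj (cinner y x)"
    and cinner_add_left: "cinner (x + y) z = cinner x z + cinner y z"
    and cinner_scaleC_left: "cinner (c *\<^sub>C x) y = c * cinner x y"
    and cinner_self: "cinner x x = complex_of_real ((norm x)\<^sup>2)"

text \<open>Separable complex Hilbert spaces: a metric space is separable iff it is second countable,
  so separability and completeness are both contained in \<^class>\<open>polish_space\<close>.\<close>

class complex_hilbert = complex_inner + polish_space

instantiation complex :: complex_hilbert
begin

definition scaleC_complex :: "complex \<Rightarrow> complex \<Rightarrow> complex"
  where "scaleC_complex c x = c * x"

definition cinner_complex :: "complex \<Rightarrow> complex \<Rightarrow> complex"
  where "cinner_complex x y = x * cnj y"

instance
proof
  fix x :: complex
  show "cinner x x = complex_of_real ((norm x)\<^sup>2)"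
    unfolding cinner_complex_def by (rule complex_norm_square [symmetric])
qed (simp_all add: scaleC_complex_def cinner_complex_def algebra_simps scaleR_conv_of_real)

end

definition bounded_clinear :: "('a::complex_inner \<Rightarrow> 'b::complex_inner) \<Rightarrow> bool" where
  "bounded_clinear T \<longleftrightarrow> bounded_linear T \<and> (\<forall>c x. T (c *\<^sub>C x) = c *\<^sub>C T x)"

definition cadjoint :: "('a::complex_hilbert \<Rightarrow> 'b::complex_hilbert) \<Rightarrow> 'b \<Rightarrow> 'a" where
  "cadjoint T = (THE T'. \<forall>x y. cinner (T x) y = cinner x (T' y))"

definition cisometry :: "('a::complex_inner \<Rightarrow> 'b::complex_inner) \<Rightarrow> bool" where
  "cisometry V \<longleftrightarrow> bounded_clinear V \<and> (\<forall>x. norm (V x) = norm x)"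

definition unitary_op :: "('a::complex_inner \<Rightarrow> 'b::complex_inner) \<Rightarrow> bool" where
  "unitary_op U \<longleftrightarrow> cisometry U \<and> surj U"

definition unitarily_equivalent ::
    "('a::complex_inner \<Rightarrow> 'a) \<Rightarrow> ('b::complex_inner \<Rightarrow> 'b) \<Rightarrow> bool" where
  "unitarily_equivalent S T \<longleftrightarrow> (\<exists>U :: 'a \<Rightarrow> 'b. unitary_op U \<and> U \<circ> S = T \<circ> U)"

abbreviation unit_disc :: "complex set" where
  "unit_disc \<equiv> ball 0 1"

text \<open>A function on the disc is represented by its extensional version, so that equality
  of elements of \<open>hardy2\<close> means equality on the disc.\<close>

definition hardy2 :: "(complex \<Rightarrow> 'a::complex_hilbert) set" where
  "hardy2 = {f \<in> extensional unit_disc.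
     \<exists>a :: nat \<Rightarrow> 'a. summable (\<lambda>n. (norm (a n))\<^sup>2) \<and>
       (\<forall>z\<in>unit_disc. (\<lambda>n. z ^ n *\<^sub>C a n) sums f z)}"

text \<open>Bounded analytic operator-valued functions. Strong convergence of an operator power
  series at every point of the disc already implies convergence in operator norm there
  (uniform boundedness), so this is analyticity in any of the usual senses.
  The values of \<open>\<Theta>\<close> off the disc are irrelevant.\<close>

definition hardy_inf :: "(complex \<Rightarrow> 'a::complex_hilbert \<Rightarrow> 'b::complex_hilbert) set" where
  "hardy_inf = {\<Theta>. (\<forall>z\<in>unit_disc. bounded_clinear (\<Theta> z)) \<and>
     (\<exists>T :: nat \<Rightarrow> 'a \<Rightarrow> 'b. (\<forall>n. bounded_clinear (T n)) \<and>
       (\<forall>z\<in>unit_disc. \<forall>x. (\<lambda>n. z ^ n *\<^sub>C T n x) sums \<Theta> z x)) \<and>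
     (\<exists>M. \<forall>z\<in>unit_disc. onorm (\<Theta> z) \<le> M)}"

text \<open>The boundary value at \<open>cis t\<close> is the radial limit in the strong operator topology.\<close>

definition inner_function ::
    "(complex \<Rightarrow> 'a::complex_hilbert \<Rightarrow> 'b::complex_hilbert) \<Rightarrow> bool" where
  "inner_function \<Theta> \<longleftrightarrow> \<Theta> \<in> hardy_inf \<and>
     (AE t in lebesgue_on {0..2 * pi}. \<exists>V. cisometry V \<and>
        (\<forall>x. ((\<lambda>r. \<Theta> (complex_of_real r * cis t) x) \<longlongrightarrow> V x) (at_left 1)))"

definition mult_op ::
    "(complex \<Rightarrow> 'a \<Rightarrow> 'b) \<Rightarrow> (complex \<Rightarrow> 'a) \<Rightarrow> complex \<Rightarrow> 'b" where
  "mult_op \<Phi> f = (\<lambda>z\<in>unit_disc. \<Phi> z (f z))"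

text \<open>The symbol \<open>A + A\<^sup>* z\<close>; the Toeplitz operator with this analytic symbol
  is \<open>mult_op (toeplitz_symbol A)\<close>.\<close>

definition toeplitz_symbol :: "('a::complex_hilbert \<Rightarrow> 'a) \<Rightarrow> complex \<Rightarrow> 'a \<Rightarrow> 'a" where
  "toeplitz_symbol A z x = A x + z *\<^sub>C cadjoint A x"

definition intertwines ::
    "(complex \<Rightarrow> 'a::complex_hilbert \<Rightarrow> 'b::complex_hilbert) \<Rightarrow> ('b \<Rightarrow> 'b) \<Rightarrow> ('a \<Rightarrow> 'a) \<Rightarrow> bool" where
  "intertwines \<Theta> A B \<longleftrightarrow>
     (\<forall>z\<in>unit_disc. toeplitz_symbol A z \<circ> \<Theta> z = \<Theta> z \<circ> toeplitz_symbol B z)"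

end

theory Submission
  imports Defs
begin

text \<open>A Hardy space function is the same thing as the square-summable sequence of its coefficients, and
on such sequences multiplication by \<open>z\<close> is the shift. The analytic input is the single fact
that multiplication by an inner function \<open>\<Theta>\<close> is an isometry \<open>V\<close> of Hardy spaces
(\<open>inner_function_isometry\<close>). For a polynomial \<open>p\<close>, Parseval's identity on the circle of radius
\<open>r < 1\<close> expresses the mean of \<open>\<parallel>\<Theta> p\<parallel>\<^sup>2\<close> through the coefficients of \<open>\<Theta> p\<close>; as \<open>r\<close> tends to \<open>1\<close>,
dominated convergence turns the mean into that of \<open>\<parallel>p\<parallel>\<^sup>2\<close> on the unit circle, because the boundary
values of \<open>\<Theta>\<close> are isometries. Polynomials are dense, so the isometry extends. From then on only
inner products, the shift \<open>S\<close> and the relation \<open>V S = S V\<close> matter.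

Let \<open>T\<close> be multiplication by \<open>A + A\<^sup>* z\<close>. On the unit circle the adjoint of this symbol is
\<open>A + A\<^sup>* z\<close> divided by \<open>z\<close>, which in coefficients reads
\<open>\<langle>T f, S g\<rangle> = \<langle>f, T g\<rangle>\<close> (\<open>cinner_toeplitz_shift\<close>). If the range of \<open>V\<close> is invariant under \<open>T\<close>, then
\<open>T V = V X\<close> for a bounded operator \<open>X\<close> that commutes with the shift and inherits the relation
\<open>\<langle>X f, S g\<rangle> = \<langle>f, X g\<rangle>\<close>. Apply it to a constant \<open>x\<close> and a monomial \<open>z\<^sup>m y\<close>: the next
coefficient of \<open>X x\<close>, of index \<open>m + 1\<close>, is orthogonal to every \<open>y\<close> for \<open>m \<ge> 1\<close>, and for \<open>m = 0\<close> it is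
the value at \<open>x\<close> of the adjoint \<open>B\<^sup>*\<close> of
the map \<open>B\<close> giving the constant coefficient. Hence \<open>X x = B x + z B\<^sup>* x\<close>
(\<open>toeplitz_op_compression\<close>), which is the intertwining relation. The converse is immediate.

Uniqueness of \<open>B\<close> is injectivity of \<open>V\<close>. If \<open>\<Theta>\<close> and \<open>\<Theta>'\<close> have the same range, the constants are
recovered in both cases as the orthogonal complement of the shifted range, so
\<open>\<Theta> = \<Theta>' U\<close> for a constant unitary \<open>U\<close> (\<open>wandering_subspace_unitary\<close>), and comparing constant
coefficients gives \<open>U B = B' U\<close>.\<close>

section \<open>Complex inner products and adjoints\<close>

lemma cinner_add_right: "cinner x (y + z) = cinner x y + cinner x z"
  by (metis cinner_add_left cinner_commute complex_cnj_add)

lemma cinner_scaleC_right: "cinner x (c *\<^sub>C y) = cnj c * cinner x y"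
  by (metis cinner_commute cinner_scaleC_left complex_cnj_mult)

lemma cinner_scaleR_left: "cinner (r *\<^sub>R x) y = r *\<^sub>R cinner x y"
  by (simp add: scaleR_scaleC cinner_scaleC_left scaleC_complex_def)

lemma cinner_scaleR_right: "cinner x (r *\<^sub>R y) = r *\<^sub>R cinner x y"
  by (simp add: scaleR_scaleC cinner_scaleC_right scaleC_complex_def)

lemma norm_scaleC [simp]: "norm (c *\<^sub>C (x::'a::complex_inner)) = cmod c * norm x"
proof -
  have "complex_of_real ((norm (c *\<^sub>C x))\<^sup>2) = complex_of_real ((cmod c * norm x)\<^sup>2)"
    by (simp only: cinner_self [symmetric] cinner_scaleC_left cinner_scaleC_right)
      (simp add: cinner_self power_mult_distrib complex_norm_square mult_ac del: of_real_power)
  then have "(norm (c *\<^sub>C x))\<^sup>2 = (cmod c * norm x)\<^sup>2" by (simp only: of_real_eq_iff)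
  then show ?thesis by (simp add: power2_eq_iff_nonneg)
qed

lemma norm_add_power2:
  "(norm (x + y :: 'a::complex_inner))\<^sup>2 = (norm x)\<^sup>2 + (norm y)\<^sup>2 + 2 * Re (cinner x y)"
proof -
  have "complex_of_real ((norm (x + y))\<^sup>2) = cinner (x + y) (x + y)" by (simp only: cinner_self)
  also have "\<dots> = cinner x x + cinner y y + (cinner x y + cnj (cinner x y))"
    by (simp add: cinner_add_left cinner_add_right cinner_commute [of y x])
  also have "\<dots> = complex_of_real ((norm x)\<^sup>2 + (norm y)\<^sup>2 + 2 * Re (cinner x y))"
    by (simp only: cinner_self complex_add_cnj of_real_add)
  finally show ?thesis by (simp only: of_real_eq_iff)
qed

lemma Re_cinner_le_norm: "Re (cinner x y) \<le> norm x * norm (y::'a::complex_inner)"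
proof (cases "norm x * norm y = 0")
  case True
  have z: "cinner 0 v = 0" "cinner v 0 = 0" for v :: 'a
    using cinner_add_left [of 0 0 v] cinner_add_right [of v 0 0] by auto
  show ?thesis using True z by auto
next
  case False
  have "0 \<le> (norm (norm y *\<^sub>R x + (- norm x) *\<^sub>R y))\<^sup>2" by simp
  also have "\<dots> = 2 * (norm x * norm y) * (norm x * norm y - Re (cinner x y))"
    unfolding norm_add_power2
    by (simp add: cinner_scaleR_left cinner_scaleR_right power2_eq_square algebra_simps
        del: scaleR_minus_left)
  finally have "0 \<le> 2 * (norm x * norm y) * (norm x * norm y - Re (cinner x y))" .
  moreover have "0 < 2 * (norm x * norm y)" using False by simp
  ultimately show ?thesis by (simp only: zero_le_mult_iff) linarith
qed

lemma Cauchy_Schwarz_cinner: "cmod (cinner x y) \<le> norm x * norm (y::'a::complex_inner)"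
proof -
  define c where "c = cnj (sgn (cinner x y))"
  have "cmod (cinner x y) = Re (c * cinner x y)"
    by (cases "cinner x y = 0")
      (auto simp: c_def sgn_eq complex_norm_square [symmetric] power2_eq_square mult.commute)
  also have "\<dots> = Re (cinner (c *\<^sub>C x) y)" by (simp only: cinner_scaleC_left)
  also have "\<dots> \<le> cmod c * norm x * norm y" using Re_cinner_le_norm [of "c *\<^sub>C x" y] by simp
  also have "\<dots> \<le> norm x * norm y" by (simp add: c_def norm_sgn)
  finally show ?thesis .
qed

lemma bounded_bilinear_cinner: "bounded_bilinear (cinner :: 'a::complex_inner \<Rightarrow> 'a \<Rightarrow> complex)"
proof
  show "\<exists>K. \<forall>a b :: 'a. norm (cinner a b) \<le> norm a * norm b * K"
    by (rule exI [of _ 1]) (simp add: Cauchy_Schwarz_cinner)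
qed (simp_all only: cinner_add_left cinner_add_right cinner_scaleR_left cinner_scaleR_right)

interpretation cinner: bounded_bilinear cinner by (rule bounded_bilinear_cinner)

lemma bounded_bilinear_scaleC:
  "bounded_bilinear (scaleC :: complex \<Rightarrow> 'a::complex_inner \<Rightarrow> 'a)"
proof
  show "\<exists>K. \<forall>a (b::'a). norm (a *\<^sub>C b) \<le> norm a * norm b * K"
    by (rule exI [of _ 1]) simp
qed (simp_all add: scaleC_add_left scaleC_add_right scaleR_scaleC scaleC_scaleC
      scaleC_complex_def mult.commute)

interpretation scaleC: bounded_bilinear "scaleC :: complex \<Rightarrow> 'a::complex_inner \<Rightarrow> 'a"
  by (rule bounded_bilinear_scaleC)

lemma scaleC_one [simp]: "1 *\<^sub>C x = x"
  using scaleR_scaleC [of 1 x] by simp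

lemma cinner_ext: "(\<And>y. cinner x y = cinner x' y) \<Longrightarrow> x = (x'::'a::complex_inner)"
  using cinner_self [of "x - x'"] by (simp add: cinner.diff_left)

lemma cinner_ext_right: "(\<And>y. cinner y x = cinner y x') \<Longrightarrow> x = (x'::'a::complex_inner)"
  by (metis cinner_commute cinner_ext)

lemma bounded_clinearD:
  assumes "bounded_clinear T"
  shows "bounded_linear T" "T (x + y) = T x + T y" "T (x - y) = T x - T y" "T 0 = 0"
    "T (c *\<^sub>C x) = c *\<^sub>C T x"
  using assms unfolding bounded_clinear_def
  by (auto simp: linear_simps)

lemma bounded_clinearI:
  assumes "\<And>x y. T (x + y) = T x + T y" "\<And>c x. T (c *\<^sub>C x) = c *\<^sub>C T x"
    and "\<And>x. norm (T x) \<le> K * norm x"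
  shows "bounded_clinear T"
  unfolding bounded_clinear_def
proof (intro conjI allI)
  show "bounded_linear T"
    by (rule bounded_linear_intro [of _ K])
      (use assms in \<open>simp_all add: scaleR_scaleC mult.commute\<close>)
qed (fact assms(2))

text \<open>Over the complex numbers the norm determines the inner product: expanding the norm of a sum
  gives the real part, and rotating one argument turns the imaginary part into a real part.\<close>

lemma cisometry_cinner:
  assumes "cisometry V"
  shows "cinner (V x) (V y) = cinner x y"
proof -
  have V: "bounded_clinear V" "\<And>x. norm (V x) = norm x" using assms unfolding cisometry_def by auto
  have Re_eq: "Re (cinner (V x) (V y)) = Re (cinner x y)" for x
    using norm_add_power2 [of "V x" "V y"] norm_add_power2 [of x y] V(2) [of "x + y"]
    by (simp add: bounded_clinearD(2) [OF V(1)] V(2))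
  show ?thesis
    using Re_eq [of x] Re_eq [of "\<i> *\<^sub>C x"]
    by (simp add: bounded_clinearD(5) [OF V(1)] cinner_scaleC_left complex_eq_iff)
qed

text \<open>A bounded functional is represented by the minimiser of \<open>\<parallel>x\<parallel>\<^sup>2 / 2 - Re (\<phi> x)\<close>:
  the parallelogram law makes every minimising sequence a Cauchy sequence, and the derivative
  of the functional at its minimum vanishes in every direction.\<close>

lemma Riesz_representation:
  fixes \<phi> :: "'a::complex_hilbert \<Rightarrow> complex"
  assumes "bounded_clinear \<phi>"
  obtains v where "\<And>x. \<phi> x = cinner x v"
proof -
  obtain K where K: "\<And>x. cmod (\<phi> x) \<le> norm x * K" "0 \<le> K"
    using bounded_linear.nonneg_bounded [OF bounded_clinearD(1) [OF assms]] by blast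
  have lin: "\<phi> (x + y) = \<phi> x + \<phi> y" "\<phi> (r *\<^sub>R x) = r *\<^sub>R \<phi> x" for x y r
    using bounded_clinearD(1) [OF assms] by (auto simp: linear_simps)
  define J where "J x = (norm x)\<^sup>2 / 2 - Re (\<phi> x)" for x
  have J_ge: "J x \<ge> - K\<^sup>2 / 2" for x
  proof -
    have "Re (\<phi> x) \<le> norm x * K" using complex_Re_le_cmod [of "\<phi> x"] K(1) [of x] by linarith
    moreover have "0 \<le> (norm x - K)\<^sup>2" by simp
    ultimately show ?thesis by (simp add: J_def power2_diff)
  qed
  define m where "m = Inf (range J)"
  have bdd: "bdd_below (range J)" using J_ge by (meson bdd_belowI2)
  have m_le: "m \<le> J x" for x unfolding m_def by (rule cInf_lower [OF _ bdd]) simp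
  have "\<exists>x. J x < m + 1 / real (Suc n)" for n
    using cInf_lessD [of "range J" "m + 1 / real (Suc n)"] unfolding m_def by auto
  then obtain X where X: "\<And>n. J (X n) < m + 1 / real (Suc n)" by metis
  have par: "(norm (x - y))\<^sup>2 / 4 \<le> J x + J y - 2 * m" for x y
  proof -
    have "J ((1/2) *\<^sub>R (x + y)) = (norm (x + y))\<^sup>2 / 8 - (Re (\<phi> x) + Re (\<phi> y)) / 2"
      by (simp only: J_def lin norm_scaleR) (simp add: power_divide add_divide_distrib)
    moreover have "(norm (x - y))\<^sup>2 = (norm x)\<^sup>2 + (norm y)\<^sup>2 - 2 * Re (cinner x y)"
      using norm_add_power2 [of x "- y"] by (simp add: cinner.minus_right)
    ultimately have "(norm (x - y))\<^sup>2 / 4 = J x + J y - 2 * J ((1/2) *\<^sub>R (x + y))"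
      using norm_add_power2 [of x y] unfolding J_def [of x] J_def [of y]
      by (simp add: field_simps)
    then show ?thesis using m_le [of "(1/2) *\<^sub>R (x + y)"] by linarith
  qed
  have "Cauchy X"
  proof (rule metric_CauchyI)
    fix e :: real assume e: "e > 0"
    obtain N where N: "8 / e\<^sup>2 < real (Suc N)" 
      using reals_Archimedean2 [of "8 / e\<^sup>2"] by (meson less_SucI less_trans of_nat_less_iff lessI)
    have "dist (X i) (X j) < e" if "i \<ge> N" "j \<ge> N" for i j
    proof -
      have le: "1 / real (Suc k) \<le> 1 / real (Suc N)" if "k \<ge> N" for k
        using that by (simp add: field_simps)
      have "(norm (X i - X j))\<^sup>2 / 4 < 2 / real (Suc N)"
        using par [of "X i" "X j"] X [of i] X [of j] le [OF that(1)] le [OF that(2)] by simp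
      also have "\<dots> < e\<^sup>2 / 4" using N e by (simp add: field_simps)
      finally show ?thesis using e by (simp add: dist_norm power_less_imp_less_base)
    qed
    then show "\<exists>N. \<forall>i\<ge>N. \<forall>j\<ge>N. dist (X i) (X j) < e" by blast
  qed
  then obtain v where v: "X \<longlonglongrightarrow> v" using Cauchy_convergent convergent_def by blast
  have "(\<lambda>n. J (X n)) \<longlonglongrightarrow> J v"
    unfolding J_def
    by (intro tendsto_intros v bounded_linear.tendsto [OF bounded_clinearD(1) [OF assms]]) auto
  moreover have "(\<lambda>n. m + 1 / real (Suc n)) \<longlonglongrightarrow> m + 0"
    using LIMSEQ_Suc [OF lim_1_over_n] by (intro tendsto_intros) simp
  ultimately have "J v \<le> m + 0"
    by (rule LIMSEQ_le) (use X less_imp_le in blast)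
  then have J_min: "J v \<le> J x" for x using m_le [of x] by simp
  have Re_eq: "Re (\<phi> x) = Re (cinner x v)" for x
  proof (rule ccontr)
    assume ne: "Re (\<phi> x) \<noteq> Re (cinner x v)"
    define d where "d = Re (\<phi> x) - Re (cinner x v)"
    have "0 \<le> t\<^sup>2 * (norm x)\<^sup>2 / 2 - t * d" for t
    proof -
      have "Re (cinner v x) = Re (cinner x v)" by (subst cinner_commute) simp
      then have "J (v + t *\<^sub>R x) = J v + t\<^sup>2 * (norm x)\<^sup>2 / 2 - t * d"
        by (simp add: J_def norm_add_power2 lin d_def cinner.scaleR_right power_mult_distrib
            algebra_simps)
      then show ?thesis using J_min [of "v + t *\<^sub>R x"] by linarith
    qed
    \<comment> \<open>The added \<open>1\<close> keeps the denominator positive when \<open>x = 0\<close>; at this \<open>t\<close> the quadratic is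
      negative unless \<open>d = 0\<close>.\<close>
    moreover define s t where "s = (norm x)\<^sup>2 + 1" and "t = d / s"
    moreover have "s > 0" unfolding s_def by (intro add_nonneg_pos) auto
    ultimately have "0 \<le> t\<^sup>2 * (s - 1) / 2 - t * (t * s)" by (metis add_diff_cancel_right'
          less_irrefl nonzero_eq_divide_eq)
    then have "t\<^sup>2 * (s + 1) \<le> 0" by (simp add: algebra_simps power2_eq_square)
    moreover have "t\<^sup>2 > 0" using ne \<open>s > 0\<close> by (simp add: t_def d_def)
    ultimately show False using \<open>s > 0\<close> by (simp add: mult_le_0_iff)
  qed
  show thesis
  proof
    show "\<phi> x = cinner x v" for x
      using Re_eq [of x] Re_eq [of "\<i> *\<^sub>C x"] bounded_clinearD(5) [OF assms, of \<i> x]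
      by (simp add: cinner_scaleC_left complex_eq_iff scaleC_complex_def)
  qed
qed

lemma cadjoint_eqI:
  fixes T :: "'a::complex_hilbert \<Rightarrow> 'b::complex_hilbert"
  assumes "\<And>x y. cinner (T x) y = cinner x (T' y)"
  shows "cadjoint T = T'"
  unfolding cadjoint_def
proof (rule the_equality)
  fix T'' assume "\<forall>x y. cinner (T x) y = cinner x (T'' y)"
  then have "cinner x (T'' y) = cinner x (T' y)" for x y using assms by metis
  then show "T'' = T'" by (rule ext [OF cinner_ext_right])
qed (use assms in simp)

lemma
  fixes T :: "'a::complex_hilbert \<Rightarrow> 'b::complex_hilbert"
  assumes "bounded_clinear T"
  shows cinner_cadjoint: "cinner (T x) y = cinner x (cadjoint T y)"
    and cinner_cadjoint_left: "cinner (cadjoint T y) x = cinner y (T x)"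
proof -
  have "\<exists>v. \<forall>x. cinner (T x) y = cinner x v" for y
  proof -
    obtain K where K: "\<And>x. norm (T x) \<le> norm x * K"
      using bounded_linear.nonneg_bounded [OF bounded_clinearD(1) [OF assms]] by blast
    have "bounded_clinear (\<lambda>x. cinner (T x) y)"
    proof (rule bounded_clinearI)
      show "cmod (cinner (T x) y) \<le> (K * norm y) * norm x" for x
        using Cauchy_Schwarz_cinner [of "T x" y] mult_right_mono [OF K, of "norm y" x]
        by (simp add: mult_ac)
    qed (simp_all add: bounded_clinearD [OF assms] cinner_add_left cinner_scaleC_left
          scaleC_complex_def)
    then show ?thesis by (metis Riesz_representation)
  qed
  then obtain T' where T': "\<forall>x y. cinner (T x) y = cinner x (T' y)" by metis
  then have "cadjoint T = T'" by (intro cadjoint_eqI) blast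
  with T' show *: "cinner (T x) y = cinner x (cadjoint T y)" for x y by blast
  then show "cinner (cadjoint T y) x = cinner y (T x)" by (metis cinner_commute)
qed

lemma bounded_clinear_cadjoint:
  fixes T :: "'a::complex_hilbert \<Rightarrow> 'b::complex_hilbert"
  assumes "bounded_clinear T"
  shows "bounded_clinear (cadjoint T)"
proof -
  obtain K where K: "\<And>x. norm (T x) \<le> norm x * K" "0 \<le> K"
    using bounded_linear.nonneg_bounded [OF bounded_clinearD(1) [OF assms]] by blast
  note adj = cinner_cadjoint_left [OF assms]
  show ?thesis
  proof (rule bounded_clinearI)
    show "cadjoint T (x + y) = cadjoint T x + cadjoint T y" for x y
      by (rule cinner_ext) (simp add: adj cinner_add_left)
    show "cadjoint T (c *\<^sub>C x) = c *\<^sub>C cadjoint T x" for c x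
      by (rule cinner_ext) (simp add: adj cinner_scaleC_left)
    show "norm (cadjoint T y) \<le> K * norm y" for y
    proof -
      let ?v = "cadjoint T y"
      have "(norm ?v)\<^sup>2 = cmod (cinner ?v ?v)" by (simp add: cinner_self norm_power)
      also have "\<dots> \<le> norm y * norm (T ?v)" by (simp only: adj Cauchy_Schwarz_cinner)
      also have "\<dots> \<le> norm y * (norm ?v * K)" by (intro mult_left_mono K) simp
      finally have "norm ?v * norm ?v \<le> norm ?v * (K * norm y)"
        by (simp add: power2_eq_square mult_ac)
      then show ?thesis using K(2) by (cases "norm ?v = 0") (auto simp: mult_le_cancel_left)
    qed
  qed
qed

section \<open>Square-summable sequences\<close>

lemma summable_norm_add_power2:
  fixes a b :: "nat \<Rightarrow> 'a::complex_inner"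
  assumes "summable (\<lambda>n. (norm (a n))\<^sup>2)" "summable (\<lambda>n. (norm (b n))\<^sup>2)"
  shows "summable (\<lambda>n. (norm (a n + b n))\<^sup>2)"
proof (rule summable_comparison_test')
  show "summable (\<lambda>n. 2 * (norm (a n))\<^sup>2 + 2 * (norm (b n))\<^sup>2)"
    using assms by (intro summable_add summable_mult)
  show "norm ((norm (a n + b n))\<^sup>2) \<le> 2 * (norm (a n))\<^sup>2 + 2 * (norm (b n))\<^sup>2" for n
  proof -
    have "(norm (a n + b n))\<^sup>2 \<le> (norm (a n) + norm (b n))\<^sup>2"
      by (intro power_mono norm_triangle_ineq) simp
    moreover have "0 \<le> (norm (a n) - norm (b n))\<^sup>2" by simp
    ultimately show ?thesis by (simp add: power2_diff power2_sum)
  qed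
qed

lemma summable_norm_scaleC_power2:
  assumes "summable (\<lambda>n. (norm (a n :: 'a::complex_inner))\<^sup>2)"
  shows "summable (\<lambda>n. (norm (c *\<^sub>C a n))\<^sup>2)"
  using summable_mult [OF assms, of "(cmod c)\<^sup>2"] by (simp add: power_mult_distrib)

lemma summable_cinner:
  fixes a b :: "nat \<Rightarrow> 'a::complex_inner"
  assumes "summable (\<lambda>n. (norm (a n))\<^sup>2)" "summable (\<lambda>n. (norm (b n))\<^sup>2)"
  shows "summable (\<lambda>n. cinner (a n) (b n))"
proof (rule summable_comparison_test')
  show "summable (\<lambda>n. (norm (a n))\<^sup>2 + (norm (b n))\<^sup>2)"
    using assms by (intro summable_add)
  show "norm (cinner (a n) (b n)) \<le> (norm (a n))\<^sup>2 + (norm (b n))\<^sup>2" for n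
  proof -
    have "norm (cinner (a n) (b n)) \<le> norm (a n) * norm (b n)" by (rule Cauchy_Schwarz_cinner)
    moreover have "0 \<le> (norm (a n) - norm (b n))\<^sup>2" by simp
    moreover have "0 \<le> norm (a n) * norm (b n)" by simp
    ultimately show ?thesis unfolding power2_diff by linarith
  qed
qed

lemma norm_ell2_triangle:
  fixes a b :: "nat \<Rightarrow> 'a::complex_inner"
  assumes "summable (\<lambda>n. (norm (a n))\<^sup>2)" "summable (\<lambda>n. (norm (b n))\<^sup>2)"
  shows "sqrt (\<Sum>n. (norm (a n + b n))\<^sup>2) \<le> sqrt (\<Sum>n. (norm (a n))\<^sup>2) + sqrt (\<Sum>n. (norm (b n))\<^sup>2)"
    (is "_ \<le> ?R")
proof -
  have L2: "L2_set (\<lambda>i. norm (f i)) {..<N} \<le> sqrt (\<Sum>n. (norm (f n))\<^sup>2)"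
    if "summable (\<lambda>n. (norm (f n))\<^sup>2)" for f :: "nat \<Rightarrow> 'a" and N
    unfolding L2_set_def using that by (intro real_sqrt_le_mono sum_le_suminf) auto
  have "(\<Sum>n<N. (norm (a n + b n))\<^sup>2) \<le> ?R\<^sup>2" for N
  proof -
    have "L2_set (\<lambda>i. norm (a i + b i)) {..<N} \<le> L2_set (\<lambda>i. norm (a i) + norm (b i)) {..<N}"
      by (intro L2_set_mono) (auto intro: norm_triangle_ineq)
    also have "\<dots> \<le> ?R"
      using L2_set_triangle_ineq L2 [OF assms(1), of N] L2 [OF assms(2), of N]
      by (rule order_trans [OF _ add_mono])
    finally have "(L2_set (\<lambda>i. norm (a i + b i)) {..<N})\<^sup>2 \<le> ?R\<^sup>2"
      by (intro power_mono) (auto simp: L2_set_nonneg)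
    then show ?thesis by (simp add: L2_set_def sum_nonneg)
  qed
  then have "(\<Sum>n. (norm (a n + b n))\<^sup>2) \<le> ?R\<^sup>2"
    by (intro suminf_le_const summable_norm_add_power2 assms)
  then show ?thesis
    using assms by (intro real_le_lsqrt add_nonneg_nonneg real_sqrt_ge_zero suminf_nonneg) auto
qed

text \<open>Coefficient sequences form a type of class \<^class>\<open>complex_inner\<close>, so that the facts on inner products and
isometries above apply to Hardy space functions.\<close>

typedef (overloaded) 'a ell2 =
  "{a :: nat \<Rightarrow> 'a::complex_inner. summable (\<lambda>n. (norm (a n))\<^sup>2)}"
  morphisms ell2_coeff Abs_ell2
  by (rule exI [of _ "\<lambda>_. 0"]) simp

setup_lifting type_definition_ell2

instantiation ell2 :: (complex_inner) complex_vector
begin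

lift_definition zero_ell2 :: "'a ell2" is "\<lambda>_. 0" by simp
lift_definition plus_ell2 :: "'a ell2 \<Rightarrow> 'a ell2 \<Rightarrow> 'a ell2" is "\<lambda>a b n. a n + b n"
  by (rule summable_norm_add_power2)
lift_definition scaleC_ell2 :: "complex \<Rightarrow> 'a ell2 \<Rightarrow> 'a ell2" is "\<lambda>c a n. c *\<^sub>C a n"
  by (rule summable_norm_scaleC_power2)
lift_definition scaleR_ell2 :: "real \<Rightarrow> 'a ell2 \<Rightarrow> 'a ell2" is "\<lambda>r a n. r *\<^sub>R a n"
  unfolding scaleR_scaleC by (rule summable_norm_scaleC_power2)
lift_definition uminus_ell2 :: "'a ell2 \<Rightarrow> 'a ell2" is "\<lambda>a n. - a n" by simp
lift_definition minus_ell2 :: "'a ell2 \<Rightarrow> 'a ell2 \<Rightarrow> 'a ell2" is "\<lambda>a b n. a n - b n"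
  subgoal for a b using summable_norm_add_power2 [of a "\<lambda>n. - b n"] by simp
  done

instance
proof
  fix a b c :: "'a ell2" and r s :: real and u v :: complex
  show "a + b + c = a + (b + c)" by transfer (simp add: add.assoc)
  show "a + b = b + a" by transfer (simp add: add.commute)
  show "0 + a = a" by transfer simp
  show "- a + a = 0" by transfer simp
  show "a - b = a + - b" by transfer simp
  show "u *\<^sub>C (a + b) = u *\<^sub>C a + u *\<^sub>C b" by transfer (simp add: scaleC_add_right)
  show "(u + v) *\<^sub>C a = u *\<^sub>C a + v *\<^sub>C a" by transfer (simp add: scaleC_add_left)
  show "u *\<^sub>C v *\<^sub>C a = (u * v) *\<^sub>C a" by transfer (simp add: scaleC_scaleC)
  show "r *\<^sub>R a = complex_of_real r *\<^sub>C a" by transfer (simp add: scaleR_scaleC)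
  show "r *\<^sub>R (a + b) = r *\<^sub>R a + r *\<^sub>R b" by transfer (simp add: scaleR_add_right)
  show "(r + s) *\<^sub>R a = r *\<^sub>R a + s *\<^sub>R a" by transfer (simp add: scaleR_add_left)
  show "r *\<^sub>R s *\<^sub>R a = (r * s) *\<^sub>R a" by transfer simp
  show "1 *\<^sub>R a = a" by transfer simp
qed

end

instantiation ell2 :: (complex_inner) complex_inner
begin

lift_definition cinner_ell2 :: "'a ell2 \<Rightarrow> 'a ell2 \<Rightarrow> complex" is
  "\<lambda>a b. \<Sum>n. cinner (a n) (b n)" .
lift_definition norm_ell2 :: "'a ell2 \<Rightarrow> real" is "\<lambda>a. sqrt (\<Sum>n. (norm (a n))\<^sup>2)" .
definition dist_ell2 :: "'a ell2 \<Rightarrow> 'a ell2 \<Rightarrow> real" where "dist_ell2 a b = norm (a - b)"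
definition sgn_ell2 :: "'a ell2 \<Rightarrow> 'a ell2" where "sgn_ell2 a = a /\<^sub>R norm a"
definition uniformity_ell2 :: "('a ell2 \<times> 'a ell2) filter"
  where "uniformity_ell2 = (INF e\<in>{0 <..}. principal {(x, y). dist x y < e})"
definition open_ell2 :: "'a ell2 set \<Rightarrow> bool"
  where "open_ell2 U \<longleftrightarrow> (\<forall>x\<in>U. eventually (\<lambda>(x', y). x' = x \<longrightarrow> y \<in> U) uniformity)"

instance
proof
  fix a b c :: "'a ell2" and r s :: real and u v :: complex
  show "dist a b = norm (a - b)" by (rule dist_ell2_def)
  show "sgn a = a /\<^sub>R norm a" by (rule sgn_ell2_def)
  show "(uniformity :: ('a ell2 \<times> 'a ell2) filter) = (INF e\<in>{0 <..}. principal {(x, y). dist x y < e})"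
    by (rule uniformity_ell2_def)
  show "open U \<longleftrightarrow> (\<forall>x\<in>U. eventually (\<lambda>(x', y). x' = x \<longrightarrow> y \<in> U) uniformity)"
    for U :: "'a ell2 set"
    by (rule open_ell2_def)
  show "norm a = 0 \<longleftrightarrow> a = 0" by transfer (simp add: suminf_eq_zero_iff fun_eq_iff)
  show "norm (a + b) \<le> norm a + norm b" by transfer (rule norm_ell2_triangle)
  show "norm (r *\<^sub>R a) = \<bar>r\<bar> * norm a"
    by transfer (simp add: power_mult_distrib suminf_mult real_sqrt_mult)
  show "cinner a b = cnj (cinner b a)"
  proof transfer
    fix a b :: "nat \<Rightarrow> 'a"
    assume "summable (\<lambda>n. (norm (a n))\<^sup>2)" "summable (\<lambda>n. (norm (b n))\<^sup>2)"
    then have "(\<lambda>n. cinner (b n) (a n)) sums (\<Sum>n. cinner (b n) (a n))"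
      by (intro summable_sums summable_cinner)
    then have "(\<lambda>n. cnj (cinner (b n) (a n))) sums cnj (\<Sum>n. cinner (b n) (a n))"
      by (simp add: sums_cnj)
    then show "(\<Sum>n. cinner (a n) (b n)) = cnj (\<Sum>n. cinner (b n) (a n))"
      by (simp add: cinner_commute [symmetric] sums_iff)
  qed
  show "cinner (a + b) c = cinner a c + cinner b c"
    by transfer (simp add: cinner_add_left suminf_add summable_cinner)
  show "cinner (u *\<^sub>C a) b = u * cinner a b"
    by transfer (simp add: cinner_scaleC_left suminf_mult summable_cinner)
  show "cinner a a = complex_of_real ((norm a)\<^sup>2)"
  proof transfer
    fix a :: "nat \<Rightarrow> 'a"
    assume a: "summable (\<lambda>n. (norm (a n))\<^sup>2)"
    show "(\<Sum>n. cinner (a n) (a n)) = complex_of_real ((sqrt (\<Sum>n. (norm (a n))\<^sup>2))\<^sup>2)"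
      using suminf_of_real [OF a, where 'a = complex]
      by (simp add: cinner_self suminf_nonneg [OF a])
  qed
qed

end

lemma coeff_simps [simp]:
  "ell2_coeff 0 n = 0" "ell2_coeff (a + b) n = ell2_coeff a n + ell2_coeff b n"
  "ell2_coeff (a - b) n = ell2_coeff a n - ell2_coeff b n"
  "ell2_coeff (- a) n = - ell2_coeff a n" "ell2_coeff (c *\<^sub>C a) n = c *\<^sub>C ell2_coeff a n"
  by (transfer; simp)+

lemma coeff_sum [simp]: "ell2_coeff (\<Sum>i\<in>I. f i) n = (\<Sum>i\<in>I. ell2_coeff (f i) n)"
  by (induction I rule: infinite_finite_induct) auto

lemma ell2_eqI: "(\<And>n. ell2_coeff a n = ell2_coeff b n) \<Longrightarrow> a = b"
  by transfer auto

lemma coeff_Abs_ell2: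
  "summable (\<lambda>n. (norm (f n))\<^sup>2) \<Longrightarrow> ell2_coeff (Abs_ell2 f) n = f n"
  by (simp add: Abs_ell2_inverse)

lemma norm_ell2_sums: "(\<lambda>n. (norm (ell2_coeff a n))\<^sup>2) sums (norm a)\<^sup>2"
  by transfer (simp add: suminf_nonneg summable_sums)

lemma norm_coeff_le: "norm (ell2_coeff a n) \<le> norm a"
proof -
  have "(\<Sum>i\<in>{n}. (norm (ell2_coeff a i))\<^sup>2) \<le> (norm a)\<^sup>2"
    using norm_ell2_sums [of a] sum_le_suminf [of "\<lambda>i. (norm (ell2_coeff a i))\<^sup>2" "{n}"]
    by (auto simp: sums_iff)
  then show ?thesis by (simp add: power2_le_iff_abs_le)
qed

lemma norm_ell2_eqI:
  assumes "(\<lambda>n. (norm (ell2_coeff a n))\<^sup>2) sums s\<^sup>2" "s \<ge> 0"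
  shows "norm a = s"
  using sums_unique2 [OF norm_ell2_sums assms(1)] assms(2) by (simp add: power2_eq_iff_nonneg)

lemma cinner_ell2: "cinner a b = (\<Sum>n. cinner (ell2_coeff a n) (ell2_coeff b n))"
  by transfer simp

lift_definition ell2_monom :: "nat \<Rightarrow> 'a::complex_inner \<Rightarrow> 'a ell2" is "\<lambda>k x n. if n = k then x else 0"
  by (rule summable_finite [of "{k}" for k]) auto

lemma coeff_monom [simp]: "ell2_coeff (ell2_monom k x) n = (if n = k then x else 0)"
  by transfer simp

lemma cinner_monom: "cinner a (ell2_monom k y) = cinner (ell2_coeff a k) y"
proof -
  have "(\<lambda>n. cinner (ell2_coeff a n) (if n = k then y else 0)) =
      (\<lambda>n. if n = k then cinner (ell2_coeff a n) y else 0)" by (auto simp: cinner.zero_right)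
  then have "(\<lambda>n. cinner (ell2_coeff a n) (ell2_coeff (ell2_monom k y) n)) sums cinner (ell2_coeff a k) y"
    using sums_single [of k "\<lambda>n. cinner (ell2_coeff a n) y"] by simp
  then show ?thesis by (simp add: cinner_ell2 sums_iff)
qed

lemma cinner_monom_left: "cinner (ell2_monom k y) a = cinner y (ell2_coeff a k)"
  by (metis cinner_commute cinner_monom)

lemma norm_monom [simp]: "norm (ell2_monom k x) = norm x"
proof (rule norm_ell2_eqI)
  have "(\<lambda>n. (norm (ell2_coeff (ell2_monom k x) n))\<^sup>2) = (\<lambda>n. if n = k then (norm x)\<^sup>2 else 0)" by auto
  then show "(\<lambda>n. (norm (ell2_coeff (ell2_monom k x) n))\<^sup>2) sums (norm x)\<^sup>2"
    using sums_single [of k "\<lambda>n. (norm x)\<^sup>2"] by simp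
qed simp

lemma ell2_monom_add: "ell2_monom k (x + y) = ell2_monom k x + ell2_monom k y"
  by (rule ell2_eqI) simp

lemma ell2_monom_scaleC: "ell2_monom k (c *\<^sub>C x) = c *\<^sub>C ell2_monom k x"
  by (rule ell2_eqI) (simp add: scaleC.zero_right)

definition truncate :: "nat \<Rightarrow> 'a::complex_inner ell2 \<Rightarrow> 'a ell2" where
  "truncate N a = (\<Sum>k<N. ell2_monom k (ell2_coeff a k))"

lemma coeff_truncate [simp]: "ell2_coeff (truncate N a) n = (if n < N then ell2_coeff a n else 0)"
  by (simp add: truncate_def sum.delta)

text \<open>Finite sequences are dense. Continuous operators on Hardy spaces are therefore determined by
their values on polynomials.\<close>

lemma truncate_tendsto: "(\<lambda>N. truncate N a) \<longlonglongrightarrow> a"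
proof -
  let ?f = "\<lambda>n. (norm (ell2_coeff a n))\<^sup>2"
  have "(norm (truncate N a - a))\<^sup>2 = (norm a)\<^sup>2 - sum ?f {..<N}" for N
  proof -
    have "(\<lambda>n. ?f n - (if n \<in> {..<N} then ?f n else 0)) sums ((norm a)\<^sup>2 - sum ?f {..<N})"
      by (intro sums_diff norm_ell2_sums sums_If_finite_set) simp
    moreover have "(norm (ell2_coeff (truncate N a - a) n))\<^sup>2 = ?f n - (if n \<in> {..<N} then ?f n else 0)" for n
      by simp
    ultimately show ?thesis using norm_ell2_sums [of "truncate N a - a"] sums_unique2 by auto
  qed
  moreover have "(\<lambda>N. (norm a)\<^sup>2 - sum ?f {..<N}) \<longlonglongrightarrow> (norm a)\<^sup>2 - (norm a)\<^sup>2"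
    using norm_ell2_sums [of a] unfolding sums_def by (intro tendsto_intros)
  ultimately have "(\<lambda>N. (norm (truncate N a - a))\<^sup>2) \<longlonglongrightarrow> 0" by simp
  then have "(\<lambda>N. sqrt ((norm (truncate N a - a))\<^sup>2)) \<longlonglongrightarrow> sqrt 0" by (rule tendsto_real_sqrt)
  then show ?thesis by (simp add: LIM_zero_iff tendsto_norm_zero_iff)
qed

lift_definition ell2_shift :: "'a::complex_inner ell2 \<Rightarrow> 'a ell2" is
  "\<lambda>a n. case n of 0 \<Rightarrow> 0 | Suc m \<Rightarrow> a m"
  subgoal for a by (subst summable_Suc_iff [symmetric]) simp
  done

lemma coeff_shift [simp]:
  "ell2_coeff (ell2_shift a) 0 = 0" "ell2_coeff (ell2_shift a) (Suc n) = ell2_coeff a n"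
  by (transfer; simp)+

lemma cisometry_shift: "cisometry ell2_shift"
proof -
  have norm: "norm (ell2_shift a) = norm a" for a :: "'a ell2"
  proof (rule norm_ell2_eqI)
    show "(\<lambda>n. (norm (ell2_coeff (ell2_shift a) n))\<^sup>2) sums (norm a)\<^sup>2"
      using sums_Suc [of "\<lambda>n. (norm (ell2_coeff (ell2_shift a) n))\<^sup>2" "(norm a)\<^sup>2"]
        norm_ell2_sums [of a] by simp
  qed simp
  have "bounded_clinear (ell2_shift :: 'a ell2 \<Rightarrow> _)"
  proof (rule bounded_clinearI [where K = 1])
    fix a b :: "'a ell2" and c
    show "ell2_shift (a + b) = ell2_shift a + ell2_shift b"
    proof (rule ell2_eqI)
      show "ell2_coeff (ell2_shift (a + b)) n = ell2_coeff (ell2_shift a + ell2_shift b) n" for n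
        by (cases n) auto
    qed
    show "ell2_shift (c *\<^sub>C a) = c *\<^sub>C ell2_shift a"
    proof (rule ell2_eqI)
      show "ell2_coeff (ell2_shift (c *\<^sub>C a)) n = ell2_coeff (c *\<^sub>C ell2_shift a) n" for n
        by (cases n) (auto simp: scaleC.zero_right)
    qed
  qed (simp add: norm)
  with norm show ?thesis by (simp add: cisometry_def)
qed

lemma shift_monom: "ell2_shift (ell2_monom k x) = ell2_monom (Suc k) x"
proof (rule ell2_eqI)
  show "ell2_coeff (ell2_shift (ell2_monom k x)) n = ell2_coeff (ell2_monom (Suc k) x) n" for n
    by (cases n) auto
qed

text \<open>Meaningful for bounded \<open>A\<close>, where the image sequence is again square-summable; otherwise
\<open>Abs_ell2\<close> may be applied outside its domain.\<close>

definition ell2_map :: "('a::complex_inner \<Rightarrow> 'b::complex_inner) \<Rightarrow> 'a ell2 \<Rightarrow> 'b ell2" where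
  "ell2_map A a = Abs_ell2 (\<lambda>n. A (ell2_coeff a n))"

context
  fixes A :: "'a::complex_inner \<Rightarrow> 'b::complex_inner" and K
  assumes K: "\<And>x. norm (A x) \<le> norm x * K"
begin

lemma summable_ell2_map: "summable (\<lambda>n. (norm (A (ell2_coeff a n)))\<^sup>2)"
proof (rule summable_comparison_test')
  show "summable (\<lambda>n. (norm (ell2_coeff a n))\<^sup>2 * K\<^sup>2)"
    using norm_ell2_sums [of a] by (intro summable_mult2) (simp add: sums_iff)
  show "norm ((norm (A (ell2_coeff a n)))\<^sup>2) \<le> (norm (ell2_coeff a n))\<^sup>2 * K\<^sup>2" for n
    using power_mono [OF K, of "ell2_coeff a n" 2] by (simp add: power_mult_distrib)
qed

lemma norm_ell2_map_le: "norm (ell2_map A a) \<le> \<bar>K\<bar> * norm a"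
proof (rule power2_le_imp_le)
  have "(norm (ell2_coeff (ell2_map A a) n))\<^sup>2 \<le> (norm (ell2_coeff a n))\<^sup>2 * K\<^sup>2" for n
    using power_mono [OF K, of "ell2_coeff a n" 2]
    by (simp add: power_mult_distrib ell2_map_def coeff_Abs_ell2 [OF summable_ell2_map])
  then have "(norm (ell2_map A a))\<^sup>2 \<le> (norm a)\<^sup>2 * K\<^sup>2"
    by (rule sums_le [OF _ norm_ell2_sums sums_mult2 [OF norm_ell2_sums]])
  then show "(norm (ell2_map A a))\<^sup>2 \<le> (\<bar>K\<bar> * norm a)\<^sup>2" by (simp add: power_mult_distrib mult.commute)
qed simp

end

lemma coeff_map:
  assumes "bounded_clinear A"
  shows "ell2_coeff (ell2_map A a) n = A (ell2_coeff a n)"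
proof -
  obtain K where "\<And>x. norm (A x) \<le> norm x * K"
    using bounded_linear.bounded [OF bounded_clinearD(1) [OF assms]] by blast
  then show ?thesis unfolding ell2_map_def by (intro coeff_Abs_ell2 summable_ell2_map)
qed

lemma bounded_clinear_map:
  assumes "bounded_clinear A"
  shows "bounded_clinear (ell2_map A)"
proof -
  obtain K where K: "\<And>x. norm (A x) \<le> norm x * K"
    using bounded_linear.bounded [OF bounded_clinearD(1) [OF assms]] by blast
  show ?thesis
  proof (rule bounded_clinearI)
    show "norm (ell2_map A a) \<le> \<bar>K\<bar> * norm a" for a by (rule norm_ell2_map_le [OF K])
  qed (rule ell2_eqI, simp add: coeff_map [OF assms] bounded_clinearD [OF assms])+
qed

lemma cinner_map:
  assumes "bounded_clinear A"
  shows "cinner (ell2_map A a) b = cinner a (ell2_map (cadjoint A) b)"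
  by (simp add: cinner_ell2 coeff_map assms bounded_clinear_cadjoint cinner_cadjoint)

lemma shift_map:
  assumes "bounded_clinear A"
  shows "ell2_shift (ell2_map A a) = ell2_map A (ell2_shift a)"
proof (rule ell2_eqI)
  show "ell2_coeff (ell2_shift (ell2_map A a)) n = ell2_coeff (ell2_map A (ell2_shift a)) n" for n
    by (cases n) (simp_all add: coeff_map assms bounded_clinearD(4) [OF assms])
qed

lemma map_monom:
  assumes "bounded_clinear A"
  shows "ell2_map A (ell2_monom k x) = ell2_monom k (A x)"
  by (rule ell2_eqI) (simp add: coeff_map assms bounded_clinearD(4) [OF assms])

section \<open>Hardy space functions and their coefficients\<close>

instance complex_hilbert \<subseteq> banach ..

definition hardy_fun :: "'a::complex_hilbert ell2 \<Rightarrow> complex \<Rightarrow> 'a" where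
  "hardy_fun a = (\<lambda>z\<in>unit_disc. \<Sum>n. z ^ n *\<^sub>C ell2_coeff a n)"

text \<open>Each coefficient is bounded by the norm of the sequence, so a geometric series dominates. The
resulting continuity of point evaluations carries identities from polynomials to all of the
Hardy space.\<close>

lemma
  assumes z: "z \<in> unit_disc"
  shows hardy_fun_sums: "(\<lambda>n. z ^ n *\<^sub>C ell2_coeff a n) sums hardy_fun a z"
    and norm_hardy_fun_le: "norm (hardy_fun a z) \<le> (1 / (1 - cmod z)) * norm a"
proof -
  have le: "norm (z ^ n *\<^sub>C ell2_coeff a n) \<le> cmod z ^ n * norm a" for n
    by (simp add: norm_power mult_left_mono norm_coeff_le)
  have geo: "(\<lambda>n. cmod z ^ n * norm a) sums ((1 / (1 - cmod z)) * norm a)"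
    using z by (intro sums_mult2 geometric_sums) simp
  have sm: "summable (\<lambda>n. z ^ n *\<^sub>C ell2_coeff a n)"
    by (rule summable_comparison_test' [OF sums_summable [OF geo]]) (rule le)
  then show "(\<lambda>n. z ^ n *\<^sub>C ell2_coeff a n) sums hardy_fun a z"
    using z by (simp add: hardy_fun_def summable_sums)
  show "norm (hardy_fun a z) \<le> (1 / (1 - cmod z)) * norm a"
    using norm_suminf_le [OF le sums_summable [OF geo]] z
    unfolding sums_unique [OF geo, symmetric] by (simp add: hardy_fun_def)
qed

lemma hardy_fun_eq:
  assumes "z \<in> unit_disc" "(\<lambda>n. z ^ n *\<^sub>C ell2_coeff a n) sums s"
  shows "hardy_fun a z = s"
  using sums_unique2 [OF hardy_fun_sums assms(2)] assms(1) by simp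

lemma hardy2_eq_range: "(hardy2 :: (complex \<Rightarrow> 'a::complex_hilbert) set) = range hardy_fun"
proof
  show "(hardy2 :: (complex \<Rightarrow> 'a) set) \<subseteq> range hardy_fun"
  proof
    fix f :: "complex \<Rightarrow> 'a" assume "f \<in> hardy2"
    then obtain a where f: "f \<in> extensional unit_disc" and a: "summable (\<lambda>n. (norm (a n))\<^sup>2)"
      and sums: "\<And>z. z \<in> unit_disc \<Longrightarrow> (\<lambda>n. z ^ n *\<^sub>C a n) sums f z"
      unfolding hardy2_def by blast
    have "f z = hardy_fun (Abs_ell2 a) z" for z
    proof (cases "z \<in> unit_disc")
      case True
      then show ?thesis
        using sums_unique2 [OF sums [OF True]] hardy_fun_sums [of z "Abs_ell2 a"]
        by (simp add: coeff_Abs_ell2 a)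
    next
      case False
      then show ?thesis using f by (simp add: hardy_fun_def extensional_def)
    qed
    then have "f = hardy_fun (Abs_ell2 a)" by (rule ext)
    then show "f \<in> range hardy_fun" by simp
  qed
  show "range hardy_fun \<subseteq> (hardy2 :: (complex \<Rightarrow> 'a) set)"
  proof safe
    fix a :: "'a ell2"
    have "hardy_fun a \<in> extensional unit_disc" by (simp add: hardy_fun_def)
    moreover have "summable (\<lambda>n. (norm (ell2_coeff a n))\<^sup>2)"
      using norm_ell2_sums [of a] by (simp add: sums_iff)
    ultimately show "hardy_fun a \<in> hardy2" unfolding hardy2_def using hardy_fun_sums by blast
  qed
qed

lemma bounded_clinear_hardy_fun:
  assumes z: "z \<in> unit_disc"
  shows "bounded_clinear (\<lambda>a. hardy_fun a z)"
proof (rule bounded_clinearI)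
  fix a b :: "'a ell2" and c
  show "hardy_fun (a + b) z = hardy_fun a z + hardy_fun b z"
    using sums_add [OF hardy_fun_sums [OF z, of a] hardy_fun_sums [OF z, of b]]
    by (intro hardy_fun_eq [OF z]) (simp add: scaleC_add_right)
  show "hardy_fun (c *\<^sub>C a) z = c *\<^sub>C hardy_fun a z"
    using bounded_linear.sums [OF scaleC.bounded_linear_right hardy_fun_sums [OF z, of a], of c]
    by (intro hardy_fun_eq [OF z]) (simp add: scaleC_scaleC mult.commute)
  show "norm (hardy_fun a z) \<le> (1 / (1 - cmod z)) * norm a" by (rule norm_hardy_fun_le [OF z])
qed

lemma hardy_fun_shift:
  assumes z: "z \<in> unit_disc"
  shows "hardy_fun (ell2_shift a) z = z *\<^sub>C hardy_fun a z"
proof -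
  have "(\<lambda>n. z ^ Suc n *\<^sub>C ell2_coeff (ell2_shift a) (Suc n)) sums (z *\<^sub>C hardy_fun a z)"
    using bounded_linear.sums [OF scaleC.bounded_linear_right hardy_fun_sums [OF z, of a], of z]
    by (simp add: scaleC_scaleC)
  from sums_Suc [OF this] show ?thesis
    by (intro hardy_fun_eq [OF z]) (simp add: scaleC.zero_right)
qed

lemma hardy_fun_map:
  assumes A: "bounded_clinear A" and z: "z \<in> unit_disc"
  shows "hardy_fun (ell2_map A a) z = A (hardy_fun a z)"
  using bounded_linear.sums [OF bounded_clinearD(1) [OF A] hardy_fun_sums [OF z, of a]]
  by (intro hardy_fun_eq [OF z]) (simp add: coeff_map [OF A] bounded_clinearD(5) [OF A])

lemma hardy_fun_monom:
  assumes z: "z \<in> unit_disc"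
  shows "hardy_fun (ell2_monom k x) z = z ^ k *\<^sub>C x"
proof -
  have "(\<lambda>n. z ^ n *\<^sub>C ell2_coeff (ell2_monom k x) n) = (\<lambda>n. if n = k then z ^ n *\<^sub>C x else 0)"
    by (auto simp: scaleC.zero_right)
  with sums_single [of k "\<lambda>n. z ^ n *\<^sub>C x"] show ?thesis by (intro hardy_fun_eq [OF z]) simp
qed

section \<open>Parseval's identity on circles\<close>

lemma has_bochner_integral_cis_int:
  fixes j :: int
  assumes "j \<noteq> 0"
  shows "has_bochner_integral (lebesgue_on {0..2*pi}) (\<lambda>t. cis (of_int j * t)) 0"
proof -
  let ?F = "\<lambda>z. exp (\<i> * of_int j * z) / (\<i> * of_int j)"
  have cis: "cis (of_int j * t) = exp (\<i> * of_int j * of_real t)" for t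
    by (simp add: cis_conv_exp mult_ac)
  have "(?F has_field_derivative exp (\<i> * of_int j * z)) (at z)" for z
    using assms by (auto intro!: derivative_eq_intros)
  then have "((\<lambda>t. ?F (of_real t)) has_vector_derivative cis (of_int j * t)) (at t within {0..2*pi})" for t
    unfolding cis by (rule has_vector_derivative_real_field)
  then have "((\<lambda>t. cis (of_int j * t)) has_integral (?F (of_real (2 * pi)) - ?F (of_real 0))) {0..2*pi}"
    by (intro fundamental_theorem_of_calculus) auto
  moreover have "exp (\<i> * of_int j * of_real (2 * pi)) = 1"
    using exp_two_pi_i exp_integer_2pi [of "of_int j"] by (simp add: mult_ac)
  ultimately have "integral {0..2*pi} (\<lambda>t. cis (of_int j * t)) = 0"
    by (simp add: integral_unique)
  moreover have "integrable (lebesgue_on {0..2*pi}) (\<lambda>t. cis (of_int j * t))"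
    by (intro continuous_imp_integrable_real continuous_intros)
  ultimately show ?thesis
    by (simp add: has_bochner_integral_iff lebesgue_integral_eq_integral)
qed

text \<open>In the square of the norm of a sum, the cross terms are multiples of \<open>cis\<close> at nonzero integer
frequencies, whose integrals vanish.\<close>

lemma Parseval_polynomial:
  fixes d :: "nat \<Rightarrow> 'a::complex_inner"
  shows "has_bochner_integral (lebesgue_on {0..2*pi}) (\<lambda>t. (norm (\<Sum>k<N. cis t ^ k *\<^sub>C d k))\<^sup>2)
    (2 * pi * (\<Sum>k<N. (norm (d k))\<^sup>2))"
proof (induction N)
  case 0
  show ?case using has_bochner_integral_zero by simp
next
  case (Suc N)
  let ?M = "lebesgue_on {0..2*pi}"
  let ?s = "\<lambda>t. \<Sum>k<N. cis t ^ k *\<^sub>C d k"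
  have "has_bochner_integral ?M (\<lambda>t. cis (of_int (int k - int N) * t) * cinner (d k) (d N)) 0" if "k < N" for k
    using that has_bochner_integral_bounded_linear [OF bounded_linear_mult_left
        has_bochner_integral_cis_int [of "int k - int N"], of "cinner (d k) (d N)"] by simp
  then have "has_bochner_integral ?M
      (\<lambda>t. \<Sum>k<N. cis (of_int (int k - int N) * t) * cinner (d k) (d N)) (\<Sum>k<N. 0)"
    by (intro has_bochner_integral_sum) simp
  from has_bochner_integral_bounded_linear [OF bounded_linear_Re this]
  have "has_bochner_integral ?M
      (\<lambda>t. Re (\<Sum>k<N. cis (of_int (int k - int N) * t) * cinner (d k) (d N))) 0" by simp
  moreover have "(\<Sum>k<N. cis (of_int (int k - int N) * t) * cinner (d k) (d N)) =
      cinner (?s t) (cis t ^ N *\<^sub>C d N)" for t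
    by (simp add: cinner.sum_left cinner_scaleC_left cinner_scaleC_right Complex.DeMoivre
        cis_cnj mult.assoc [symmetric] cis_mult right_diff_distrib sum_distrib_left mult_ac)
  ultimately have cross: "has_bochner_integral ?M (\<lambda>t. 2 * Re (cinner (?s t) (cis t ^ N *\<^sub>C d N))) (2 * 0)"
    by (intro has_bochner_integral_mult_right) (simp_all only:)
  have const: "has_bochner_integral ?M (\<lambda>t. (norm (d N))\<^sup>2) (2 * pi * (norm (d N))\<^sup>2)"
    by (simp add: has_bochner_integral_iff continuous_imp_integrable_real measure_restrict_space)
  have "(norm (\<Sum>k<Suc N. cis t ^ k *\<^sub>C d k))\<^sup>2 =
      (norm (?s t))\<^sup>2 + (norm (d N))\<^sup>2 + 2 * Re (cinner (?s t) (cis t ^ N *\<^sub>C d N))" for t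
    by (simp add: norm_add_power2 norm_power)
  with has_bochner_integral_add [OF has_bochner_integral_add [OF Suc.IH const] cross]
  show ?case by (simp add: algebra_simps)
qed

text \<open>The terms at some radius between \<open>r\<close> and \<open>1\<close> are bounded, since the series converges there; passing
down to \<open>r\<close> gains a geometric factor.\<close>

lemma power_series_norm_summable:
  fixes c :: "nat \<Rightarrow> 'a::complex_inner"
  assumes sums: "\<And>z. z \<in> unit_disc \<Longrightarrow> (\<lambda>n. z ^ n *\<^sub>C c n) sums g z"
    and r: "0 \<le> r" "r < 1"
  shows "summable (\<lambda>n. r ^ n * norm (c n))"
proof -
  define \<rho> where "\<rho> = (1 + r) / 2"
  have \<rho>: "0 < \<rho>" "\<rho> < 1" "r < \<rho>" using r by (auto simp: \<rho>_def)
  have "(\<lambda>n. norm (complex_of_real \<rho> ^ n *\<^sub>C c n)) \<longlonglongrightarrow> 0"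
    using summable_LIMSEQ_zero [OF sums_summable [OF sums, of "of_real \<rho>"]] \<rho>
    by (intro tendsto_norm_zero) simp
  then have "Bseq (\<lambda>n. norm (complex_of_real \<rho> ^ n *\<^sub>C c n))"
    by (intro convergent_imp_Bseq convergentI)
  then obtain K where K: "\<And>n. \<rho> ^ n * norm (c n) \<le> K"
    unfolding Bseq_def using \<rho> by (auto simp: norm_power)
  show ?thesis
  proof (rule summable_comparison_test')
    show "summable (\<lambda>n. K * (r / \<rho>) ^ n)"
      using \<rho> r by (intro summable_mult summable_geometric) simp
    show "norm (r ^ n * norm (c n)) \<le> K * (r / \<rho>) ^ n" for n
    proof -
      have "r ^ n * norm (c n) = (\<rho> ^ n * norm (c n)) * (r / \<rho>) ^ n"
        using \<rho> by (simp add: power_divide)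
      also have "\<dots> \<le> K * (r / \<rho>) ^ n" using K [of n] r \<rho> by (intro mult_right_mono) auto
      finally show ?thesis using r by simp
    qed
  qed
qed

text \<open>The partial sums on the circle of radius \<open>r\<close> are uniformly bounded, so dominated convergence extends
Parseval's identity from polynomials to power series.\<close>

lemma Parseval_power_series:
  fixes c :: "nat \<Rightarrow> 'a::complex_inner"
  assumes sums: "\<And>z. z \<in> unit_disc \<Longrightarrow> (\<lambda>n. z ^ n *\<^sub>C c n) sums g z"
    and r: "0 \<le> r" "r < 1"
  shows "integrable (lebesgue_on {0..2*pi}) (\<lambda>t. (norm (g (of_real r * cis t)))\<^sup>2)"
    and "(\<lambda>n. (r ^ n * norm (c n))\<^sup>2) sums
      ((1 / (2*pi)) * (LINT t|lebesgue_on {0..2*pi}. (norm (g (of_real r * cis t)))\<^sup>2))"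
proof -
  let ?M = "lebesgue_on {0..2*pi}"
  let ?s = "\<lambda>N t. \<Sum>k<N. cis t ^ k *\<^sub>C (r ^ k *\<^sub>R c k)"
  define K where "K = (\<Sum>n. r ^ n * norm (c n))"
  have smK: "summable (\<lambda>n. r ^ n * norm (c n))" by (rule power_series_norm_summable [OF sums r])
  have s_int: "has_bochner_integral ?M (\<lambda>t. (norm (?s N t))\<^sup>2)
      (2 * pi * (\<Sum>k<N. (r ^ k * norm (c k))\<^sup>2))" for N
    using Parseval_polynomial [where N = N and d = "\<lambda>k. r ^ k *\<^sub>R c k"] r by simp
  have conv: "(\<lambda>N. ?s N t) \<longlonglongrightarrow> g (of_real r * cis t)" for t
    using sums [of "of_real r * cis t"] r
    by (simp add: sums_def norm_mult power_mult_distrib scaleR_scaleC scaleC_scaleC mult.commute)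
  have lim: "(\<lambda>N. (norm (?s N t))\<^sup>2) \<longlonglongrightarrow> (norm (g (of_real r * cis t)))\<^sup>2" for t
    by (intro tendsto_intros conv)
  have meas: "(\<lambda>t. (norm (?s N t))\<^sup>2) \<in> borel_measurable ?M" for N
    using s_int by (auto simp: has_bochner_integral_iff)
  have meas_g: "(\<lambda>t. (norm (g (of_real r * cis t)))\<^sup>2) \<in> borel_measurable ?M"
    by (rule borel_measurable_LIMSEQ_real [OF lim meas])
  have bound: "norm ((norm (?s N t))\<^sup>2) \<le> K\<^sup>2" for t N
  proof -
    have "norm (?s N t) \<le> (\<Sum>k<N. r ^ k * norm (c k))"
      by (rule order_trans [OF norm_sum]) (use r in \<open>simp add: norm_power\<close>)
    also have "\<dots> \<le> K" unfolding K_def by (rule sum_le_suminf [OF smK]) (use r in auto)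
    finally show ?thesis by (simp add: power_mono)
  qed
  have const: "integrable ?M (\<lambda>t. K\<^sup>2)" by (rule continuous_imp_integrable_real) simp
  note dct = meas_g meas const AE_I2 [OF lim] AE_I2 [OF bound]
  show "integrable ?M (\<lambda>t. (norm (g (of_real r * cis t)))\<^sup>2)"
    by (rule integrable_dominated_convergence [OF dct])
  have "(\<lambda>N. LINT t|?M. (norm (?s N t))\<^sup>2) \<longlonglongrightarrow> (LINT t|?M. (norm (g (of_real r * cis t)))\<^sup>2)"
    by (rule integral_dominated_convergence [OF dct])
  then have "(\<lambda>N. (1 / (2*pi)) * (2 * pi * (\<Sum>k<N. (r ^ k * norm (c k))\<^sup>2))) \<longlonglongrightarrow>
      (1 / (2*pi)) * (LINT t|?M. (norm (g (of_real r * cis t)))\<^sup>2)"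
    using s_int by (intro tendsto_mult tendsto_const) (simp add: has_bochner_integral_iff)
  then show "(\<lambda>n. (r ^ n * norm (c n))\<^sup>2) sums
      ((1 / (2*pi)) * (LINT t|?M. (norm (g (of_real r * cis t)))\<^sup>2))"
    by (simp add: sums_def)
qed

text \<open>The identity theorem for vector-valued power series: by Parseval's identity a vanishing sum has
vanishing mean square.\<close>

lemma power_series_coeff_unique:
  fixes c :: "nat \<Rightarrow> 'a::complex_inner"
  assumes "\<And>z. z \<in> unit_disc \<Longrightarrow> (\<lambda>n. z ^ n *\<^sub>C c n) sums 0"
  shows "c n = 0"
proof -
  have "(\<lambda>n. ((1/2) ^ n * norm (c n))\<^sup>2) sums 0"
    using Parseval_power_series(2) [of c "\<lambda>_. 0" "1/2"] assms by simp
  then have "((1/2) ^ n * norm (c n))\<^sup>2 = 0" for n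
    using suminf_eq_zero_iff [of "\<lambda>n. ((1/2) ^ n * norm (c n))\<^sup>2"] by (auto simp: sums_iff)
  then show ?thesis by simp
qed

lemma hardy_fun_eqI:
  assumes "\<And>z. z \<in> unit_disc \<Longrightarrow> hardy_fun a z = hardy_fun b z"
  shows "a = b"
proof (rule ell2_eqI)
  fix n
  have "ell2_coeff (a - b) n = 0"
  proof (rule power_series_coeff_unique)
    fix z assume z: "z \<in> unit_disc"
    show "(\<lambda>n. z ^ n *\<^sub>C ell2_coeff (a - b) n) sums 0"
      using hardy_fun_sums [OF z, of "a - b"] assms [OF z]
        bounded_clinearD(3) [OF bounded_clinear_hardy_fun [OF z], of a b] by simp
  qed
  then show "ell2_coeff a n = ell2_coeff b n" by simp
qed

section \<open>Multiplication by an inner function\<close>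

text \<open>For nonnegative terms, monotonicity in the radius yields both Abel's theorem and its converse: the radial
sums bound every finite partial sum in the limit, and are themselves bounded by the full sum.\<close>

lemma sums_of_radial_sums:
  fixes u :: "nat \<Rightarrow> real"
  assumes nonneg: "\<And>n. 0 \<le> u n" and r: "\<And>m. 0 \<le> r m" "\<And>m. r m \<le> 1" "r \<longlonglongrightarrow> 1"
    and sums: "\<And>m. (\<lambda>n. (r m ^ n)\<^sup>2 * u n) sums L m" and lim: "L \<longlonglongrightarrow> l"
  shows "u sums l"
proof -
  have le: "(\<Sum>n<N. u n) \<le> l" for N
  proof (rule LIMSEQ_le [OF _ lim])
    have "(\<lambda>m. \<Sum>n<N. (r m ^ n)\<^sup>2 * u n) \<longlonglongrightarrow> (\<Sum>n<N. (1 ^ n)\<^sup>2 * u n)"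
      by (intro tendsto_intros r)
    then show "(\<lambda>m. \<Sum>n<N. (r m ^ n)\<^sup>2 * u n) \<longlonglongrightarrow> (\<Sum>n<N. u n)" by simp
    have "(\<Sum>n<N. (r m ^ n)\<^sup>2 * u n) \<le> L m" for m
      using sum_le_suminf [OF sums_summable [OF sums [of m]], of "{..<N}"]
      unfolding sums_unique [OF sums [of m], symmetric] by (simp add: nonneg)
    then show "\<exists>M. \<forall>m\<ge>M. (\<Sum>n<N. (r m ^ n)\<^sup>2 * u n) \<le> L m" by blast
  qed
  then have sm: "summable u" by (rule summableI_nonneg_bounded [OF nonneg])
  have "L m \<le> suminf u" for m
  proof (rule sums_le [OF _ sums summable_sums [OF sm]])
    show "(r m ^ n)\<^sup>2 * u n \<le> u n" for n
      using r nonneg by (intro mult_left_le_one_le) (auto simp: power_le_one)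
  qed
  then have "l \<le> suminf u" using lim by (intro LIMSEQ_le_const2) auto
  moreover have "suminf u \<le> l" by (rule suminf_le_const [OF sm le])
  ultimately show ?thesis using summable_sums [OF sm] by simp
qed

text \<open>Multiplication by an inner function preserves the norm of a polynomial \<open>p\<close>. Along radii tending to
\<open>1\<close>, the values of \<open>\<Theta> p\<close> converge almost everywhere to an isometry applied to the
boundary value of \<open>p\<close>; expanding \<open>p\<close> into monomials reduces this convergence with a
moving argument to strong convergence on the finitely many coefficients.\<close>

lemma inner_function_polynomial_sums:
  fixes \<Theta> :: "complex \<Rightarrow> 'a::complex_hilbert \<Rightarrow> 'b::complex_hilbert"
  assumes inner: "inner_function \<Theta>"
    and sums: "\<And>z. z \<in> unit_disc \<Longrightarrow> (\<lambda>n. z ^ n *\<^sub>C c n) sums \<Theta> z (\<Sum>k<N. z ^ k *\<^sub>C a k)"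
  shows "(\<lambda>n. (norm (c n))\<^sup>2) sums (\<Sum>k<N. (norm (a k))\<^sup>2)"
proof -
  let ?M = "lebesgue_on {0..2*pi}"
  let ?p = "\<lambda>z. \<Sum>k<N. z ^ k *\<^sub>C a k"
  define r where "r m = real m / real (Suc m)" for m
  have r: "0 \<le> r m" "r m < 1" for m by (auto simp: r_def)
  have r1: "r \<longlonglongrightarrow> 1" unfolding r_def using LIMSEQ_n_over_Suc_n [where 'a = real] by simp
  have r_left: "filterlim r (at_left 1) sequentially"
    using r by (intro tendsto_imp_filterlim_at_left r1) simp
  have clin: "bounded_clinear (\<Theta> z)" if "z \<in> unit_disc" for z
    using inner that unfolding inner_function_def hardy_inf_def by blast
  obtain M where M: "\<And>z. z \<in> unit_disc \<Longrightarrow> onorm (\<Theta> z) \<le> M"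
    using inner unfolding inner_function_def hardy_inf_def by blast
  define K where "K = (\<Sum>k<N. norm (a k))"
  let ?g = "\<lambda>m t. (norm (\<Theta> (of_real (r m) * cis t) (?p (of_real (r m) * cis t))))\<^sup>2"
  have disc: "of_real (r m) * cis t \<in> unit_disc" for m t using r [of m] by (simp add: norm_mult)
  have meas: "?g m \<in> borel_measurable ?M" for m
    using Parseval_power_series(1) [OF sums r] by (rule borel_measurable_integrable)
  have Pars: "(\<lambda>n. (r m ^ n * norm (c n))\<^sup>2) sums ((1 / (2*pi)) * (LINT t|?M. ?g m t))" for m
    by (rule Parseval_power_series(2) [OF sums r])
  have bdry: "has_bochner_integral ?M (\<lambda>t. (norm (?p (cis t)))\<^sup>2) (2 * pi * (\<Sum>k<N. (norm (a k))\<^sup>2))"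
    by (rule Parseval_polynomial)
  have bound: "norm (?g m t) \<le> (M * K)\<^sup>2" for m t
  proof -
    let ?z = "of_real (r m) * cis t"
    have "norm (?p ?z) \<le> K"
      unfolding K_def
    proof (rule order_trans [OF norm_sum sum_mono])
      show "norm (?z ^ k *\<^sub>C a k) \<le> norm (a k)" for k
        using r [of m] by (simp add: norm_mult norm_power power_le_one mult_left_le_one_le)
    qed
    moreover have "0 \<le> M" using M [OF disc] onorm_pos_le bounded_clinearD(1) [OF clin [OF disc]]
      by (meson order_trans)
    moreover have "norm (\<Theta> ?z (?p ?z)) \<le> onorm (\<Theta> ?z) * norm (?p ?z)"
      by (rule onorm [OF bounded_clinearD(1) [OF clin [OF disc]]])
    ultimately have "norm (\<Theta> ?z (?p ?z)) \<le> M * K"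
      using mult_mono [OF M [OF disc]] by (meson norm_ge_zero order_trans)
    then show ?thesis by (simp add: power_mono)
  qed
  have "AE t in ?M. \<exists>V. cisometry V \<and>
      (\<forall>x. ((\<lambda>r. \<Theta> (complex_of_real r * cis t) x) \<longlongrightarrow> V x) (at_left 1))"
    using inner unfolding inner_function_def by blast
  then have lim: "AE t in ?M. (\<lambda>m. ?g m t) \<longlonglongrightarrow> (norm (?p (cis t)))\<^sup>2"
  proof (rule AE_mp [OF _ AE_I2], intro impI, elim exE conjE)
    fix t and V :: "'a \<Rightarrow> 'b"
    assume V: "cisometry V" and "\<forall>x. ((\<lambda>r. \<Theta> (complex_of_real r * cis t) x) \<longlongrightarrow> V x) (at_left 1)"
    then have x: "(\<lambda>m. \<Theta> (of_real (r m) * cis t) x) \<longlonglongrightarrow> V x" for x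
      using filterlim_compose [OF _ r_left] by blast
    have V': "bounded_clinear V" using V by (simp add: cisometry_def)
    have expand: "T (?p z) = (\<Sum>k<N. z ^ k *\<^sub>C T (a k))"
      if "bounded_clinear T" for z and T :: "'a \<Rightarrow> 'b"
      using bounded_clinearD [OF that] by (simp add: linear_sum bounded_linear.linear)
    have "(\<lambda>m. \<Sum>k<N. (of_real (r m) * cis t) ^ k *\<^sub>C \<Theta> (of_real (r m) * cis t) (a k)) \<longlonglongrightarrow>
        (\<Sum>k<N. (of_real 1 * cis t) ^ k *\<^sub>C V (a k))"
      by (intro tendsto_intros scaleC.tendsto x r1)
    then have "(\<lambda>m. \<Theta> (of_real (r m) * cis t) (?p (of_real (r m) * cis t))) \<longlonglongrightarrow> V (?p (cis t))"
      by (simp add: expand [OF clin [OF disc]] expand [OF V'])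
    then have "(\<lambda>m. ?g m t) \<longlonglongrightarrow> (norm (V (?p (cis t))))\<^sup>2" by (intro tendsto_intros)
    then show "(\<lambda>m. ?g m t) \<longlonglongrightarrow> (norm (?p (cis t)))\<^sup>2" using V by (simp add: cisometry_def)
  qed
  have const: "integrable ?M (\<lambda>t. (M * K)\<^sup>2)" by (rule continuous_imp_integrable_real) simp
  have "(\<lambda>m. LINT t|?M. ?g m t) \<longlonglongrightarrow> (LINT t|?M. (norm (?p (cis t)))\<^sup>2)"
    using bdry by (intro integral_dominated_convergence [OF _ meas const lim AE_I2 [OF bound]])
      (auto simp: has_bochner_integral_iff)
  then have "(\<lambda>m. (1 / (2*pi)) * (LINT t|?M. ?g m t)) \<longlonglongrightarrow>
      (1 / (2*pi)) * (2 * pi * (\<Sum>k<N. (norm (a k))\<^sup>2))"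
    using bdry by (intro tendsto_mult tendsto_const) (simp add: has_bochner_integral_iff)
  then have L: "(\<lambda>m. (1 / (2*pi)) * (LINT t|?M. ?g m t)) \<longlonglongrightarrow> (\<Sum>k<N. (norm (a k))\<^sup>2)" by simp
  show ?thesis
    by (rule sums_of_radial_sums [OF _ r(1) less_imp_le [OF r(2)] r1 _ L])
      (use Pars in \<open>simp_all add: power_mult_distrib\<close>)
qed

text \<open>Coefficients of the product of an operator power series and a vector power series.\<close>

definition convolution :: "(nat \<Rightarrow> 'a \<Rightarrow> 'b) \<Rightarrow> (nat \<Rightarrow> 'a) \<Rightarrow> nat \<Rightarrow> 'b::comm_monoid_add" where
  "convolution T a n = (\<Sum>k\<le>n. T (n - k) (a k))"

lemma convolution_truncate_sums:
  fixes T :: "nat \<Rightarrow> 'a::complex_hilbert \<Rightarrow> 'b::complex_hilbert"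
  assumes T: "\<And>n. bounded_clinear (T n)" and \<Theta>: "bounded_clinear (\<Theta> z)"
    and sums: "\<And>x. (\<lambda>n. z ^ n *\<^sub>C T n x) sums \<Theta> z x" and z: "z \<in> unit_disc"
  shows "(\<lambda>n. z ^ n *\<^sub>C convolution T (ell2_coeff (truncate N a)) n) sums
    \<Theta> z (\<Sum>k<N. z ^ k *\<^sub>C ell2_coeff a k)"
proof -
  have "(\<lambda>n. z ^ n *\<^sub>C (if k \<le> n then T (n - k) x else 0)) sums (z ^ k *\<^sub>C \<Theta> z x)" for k x
  proof -
    have "(\<lambda>n. z ^ (n + k) *\<^sub>C T n x) sums (z ^ k *\<^sub>C \<Theta> z x)"
      using bounded_linear.sums [OF scaleC.bounded_linear_right sums, of "z ^ k"]
      by (simp add: scaleC_scaleC power_add mult.commute)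
    then show ?thesis
      using sums_zero_iff_shift [of k "\<lambda>n. z ^ n *\<^sub>C (if k \<le> n then T (n - k) x else 0)"]
      by (simp add: scaleC.zero_right)
  qed
  then have "(\<lambda>n. \<Sum>k<N. z ^ n *\<^sub>C (if k \<le> n then T (n - k) (ell2_coeff a k) else 0)) sums
      (\<Sum>k<N. z ^ k *\<^sub>C \<Theta> z (ell2_coeff a k))"
    by (intro sums_sum) simp
  moreover have "convolution T (ell2_coeff (truncate N a)) n =
      (\<Sum>k<N. if k \<le> n then T (n - k) (ell2_coeff a k) else 0)" for n
    unfolding convolution_def
    by (rule sum.mono_neutral_cong) (auto simp: bounded_clinearD(4) [OF T])
  ultimately show ?thesis
    using bounded_clinearD [OF \<Theta>] by (simp add: scaleC.sum_right linear_sum bounded_linear.linear)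
qed

text \<open>The operator \<open>V\<close> is multiplication by \<open>\<Phi>\<close>, expressed on coefficient sequences.\<close>

definition has_symbol ::
    "('a::complex_hilbert ell2 \<Rightarrow> 'b::complex_hilbert ell2) \<Rightarrow> (complex \<Rightarrow> 'a \<Rightarrow> 'b) \<Rightarrow> bool" where
  "has_symbol V \<Phi> \<longleftrightarrow> (\<forall>a. \<forall>z\<in>unit_disc. hardy_fun (V a) z = \<Phi> z (hardy_fun a z))"

text \<open>The first \<open>N\<close> coefficients of the product depend only on the first \<open>N\<close> coefficients of the factor, so
the polynomial case bounds all partial sums of the squared norms of the product's
coefficients. This makes \<open>V\<close> a well-defined contraction, and
density of the polynomials then gives both the isometry property and the symbol. Commutation
with the shift is linearity of \<open>\<Theta> z\<close>.\<close>

theorem inner_function_isometry: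
  fixes \<Theta> :: "complex \<Rightarrow> 'a::complex_hilbert \<Rightarrow> 'b::complex_hilbert"
  assumes inner: "inner_function \<Theta>"
  obtains V where "cisometry V" "\<And>a. V (ell2_shift a) = ell2_shift (V a)"
    and "has_symbol V \<Theta>"
proof -
  have clin: "bounded_clinear (\<Theta> z)" if "z \<in> unit_disc" for z
    using inner that unfolding inner_function_def hardy_inf_def by blast
  obtain T :: "nat \<Rightarrow> 'a \<Rightarrow> 'b" where T: "\<And>n. bounded_clinear (T n)"
    and sums: "\<And>z x. z \<in> unit_disc \<Longrightarrow> (\<lambda>n. z ^ n *\<^sub>C T n x) sums \<Theta> z x"
    using inner unfolding inner_function_def hardy_inf_def by blast
  define V where "V a = Abs_ell2 (convolution T (ell2_coeff a))" for a
  have poly: "(\<lambda>n. z ^ n *\<^sub>C convolution T (ell2_coeff (truncate N a)) n) sums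
      \<Theta> z (\<Sum>k<N. z ^ k *\<^sub>C ell2_coeff a k)" if "z \<in> unit_disc" for z N a
    by (rule convolution_truncate_sums) (use that T clin sums in auto)
  have iso: "(\<lambda>n. (norm (convolution T (ell2_coeff (truncate N a)) n))\<^sup>2) sums (norm (truncate N a))\<^sup>2"
    for N a
  proof -
    have "(\<lambda>n. (norm (ell2_coeff (truncate N a) n))\<^sup>2) sums (\<Sum>k<N. (norm (ell2_coeff a k))\<^sup>2)"
      using sums_If_finite_set [of "{..<N}" "\<lambda>k. (norm (ell2_coeff a k))\<^sup>2"]
      by (simp add: if_distrib [of "\<lambda>x. (norm x)\<^sup>2"] cong: if_cong)
    then show ?thesis
      using sums_unique2 [OF norm_ell2_sums] inner_function_polynomial_sums [OF inner poly] by metis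
  qed
  have norm_truncate: "norm (truncate N a) \<le> norm a" for N and a :: "'a ell2"
    by (rule power2_le_imp_le [OF sums_le [OF _ norm_ell2_sums norm_ell2_sums]]) auto
  have partial: "(\<Sum>n<N. (norm (convolution T (ell2_coeff a) n))\<^sup>2) \<le> (norm a)\<^sup>2" for N a
  proof -
    have "(\<Sum>n<N. (norm (convolution T (ell2_coeff a) n))\<^sup>2) =
        (\<Sum>n<N. (norm (convolution T (ell2_coeff (truncate N a)) n))\<^sup>2)"
      by (simp add: convolution_def)
    also have "\<dots> \<le> (norm (truncate N a))\<^sup>2"
      using iso [where N = N and a = a] unfolding sums_iff
      by (metis sum_le_suminf finite_lessThan zero_le_power2)
    also have "\<dots> \<le> (norm a)\<^sup>2" by (intro power_mono norm_truncate) simp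
    finally show ?thesis .
  qed
  have coeff_V: "ell2_coeff (V a) n = convolution T (ell2_coeff a) n" for a n
    unfolding V_def by (intro coeff_Abs_ell2 summableI_nonneg_bounded [OF _ partial]) simp
  have V_le: "norm (V a) \<le> norm a" for a
  proof (rule power2_le_imp_le)
    have *: "(\<lambda>n. (norm (convolution T (ell2_coeff a) n))\<^sup>2) sums (norm (V a))\<^sup>2"
      using norm_ell2_sums [of "V a"] by (simp only: coeff_V)
    show "(norm (V a))\<^sup>2 \<le> (norm a)\<^sup>2"
      using suminf_le_const [OF sums_summable [OF *] partial] by (simp only: sums_unique [OF *])
  qed simp
  have V: "bounded_clinear V"
  proof (rule bounded_clinearI [where K = 1])
    show "norm (V a) \<le> 1 * norm a" for a using V_le by simp
  qed (rule ell2_eqI, simp add: coeff_V convolution_def bounded_clinearD [OF T] sum.distrib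
      scaleC.sum_right)+
  note V_lim = bounded_linear.tendsto [OF bounded_clinearD(1) [OF V] truncate_tendsto]
  have "norm (V a) = norm a" for a
  proof -
    have "norm (V (truncate N a)) = norm (truncate N a)" for N
      using iso by (intro norm_ell2_eqI) (simp_all add: coeff_V)
    then show ?thesis
      using LIMSEQ_unique [OF tendsto_norm [OF V_lim [of a]]] tendsto_norm [OF truncate_tendsto [of a]]
      by simp
  qed
  with V have iso_V: "cisometry V" by (simp add: cisometry_def)
  have mult: "hardy_fun (V a) z = \<Theta> z (hardy_fun a z)" if z: "z \<in> unit_disc" for a z
  proof -
    note ev = bounded_linear.tendsto [OF bounded_clinearD(1) [OF bounded_clinear_hardy_fun [OF z]]]
    have "hardy_fun (V (truncate N a)) z = \<Theta> z (hardy_fun (truncate N a) z)" for N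
    proof -
      have "hardy_fun (truncate N a) z = (\<Sum>k<N. z ^ k *\<^sub>C ell2_coeff a k)"
        using linear_sum [OF bounded_linear.linear [OF bounded_clinearD(1) [OF
              bounded_clinear_hardy_fun [OF z]]], of "\<lambda>k. ell2_monom k (ell2_coeff a k)" "{..<N}"]
        by (simp add: truncate_def hardy_fun_monom [OF z])
      then show ?thesis using poly [OF z] by (intro hardy_fun_eq [OF z]) (simp add: coeff_V)
    qed
    moreover have "(\<lambda>N. \<Theta> z (hardy_fun (truncate N a) z)) \<longlonglongrightarrow> \<Theta> z (hardy_fun a z)"
      by (rule bounded_linear.tendsto [OF bounded_clinearD(1) [OF clin [OF z]] ev [OF truncate_tendsto]])
    ultimately show ?thesis using LIMSEQ_unique [OF ev [OF V_lim [of a]]] by simp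
  qed
  have "V (ell2_shift a) = ell2_shift (V a)" for a
    by (rule hardy_fun_eqI) (simp add: mult hardy_fun_shift bounded_clinearD(5) [OF clin])
  from that [OF iso_V this] mult show thesis by (simp add: has_symbol_def)
qed

section \<open>Toeplitz operators and shift-commuting isometries\<close>

definition toeplitz_op :: "('a::complex_hilbert \<Rightarrow> 'a) \<Rightarrow> 'a ell2 \<Rightarrow> 'a ell2" where
  "toeplitz_op A a = ell2_map A a + ell2_shift (ell2_map (cadjoint A) a)"

lemma shift_simps:
  "ell2_shift (a + b) = ell2_shift a + ell2_shift b"
  "ell2_shift (c *\<^sub>C a) = c *\<^sub>C ell2_shift a"
  "cinner (ell2_shift a) (ell2_shift b) = cinner a b"
  using cisometry_shift bounded_clinearD [of ell2_shift] cisometry_cinner [OF cisometry_shift]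
  unfolding cisometry_def by blast+

lemma cisometry_inj: "cisometry V \<Longrightarrow> V a = V b \<longleftrightarrow> a = b"
  unfolding cisometry_def
  by (metis bounded_clinearD(3) eq_iff_diff_eq_0 norm_eq_zero)

context
  fixes A :: "'a::complex_hilbert \<Rightarrow> 'a"
  assumes A: "bounded_clinear A"
begin

lemma has_symbol_toeplitz: "has_symbol (toeplitz_op A) (toeplitz_symbol A)"
  unfolding has_symbol_def toeplitz_op_def toeplitz_symbol_def
  by (simp add: bounded_clinearD(2) [OF bounded_clinear_hardy_fun] hardy_fun_shift
      hardy_fun_map A bounded_clinear_cadjoint)

lemma toeplitz_op_add: "toeplitz_op A (a + b) = toeplitz_op A a + toeplitz_op A b"
  by (simp add: toeplitz_op_def shift_simps algebra_simps
      bounded_clinearD(2) [OF bounded_clinear_map] A bounded_clinear_cadjoint)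

lemma toeplitz_op_scaleC: "toeplitz_op A (c *\<^sub>C a) = c *\<^sub>C toeplitz_op A a"
  by (simp add: toeplitz_op_def shift_simps scaleC_add_right
      bounded_clinearD(5) [OF bounded_clinear_map] A bounded_clinear_cadjoint)

lemma toeplitz_op_bounded: obtains K where "\<And>a. norm (toeplitz_op A a) \<le> K * norm a"
proof -
  obtain K where K: "\<And>a. norm (ell2_map A a) \<le> norm a * K"
    using bounded_linear.bounded [OF bounded_clinearD(1) [OF bounded_clinear_map [OF A]]] by blast
  obtain L where L: "\<And>a. norm (ell2_map (cadjoint A) a) \<le> norm a * L"
    using bounded_linear.bounded [OF bounded_clinearD(1) [OF bounded_clinear_map]]
      bounded_clinear_cadjoint [OF A] by blast
  have "norm (toeplitz_op A a) \<le> (K + L) * norm a" for a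
  proof -
    have "norm (toeplitz_op A a) \<le> norm (ell2_map A a) + norm (ell2_map (cadjoint A) a)"
      using cisometry_shift norm_triangle_ineq unfolding toeplitz_op_def cisometry_def by metis
    also have "\<dots> \<le> (K + L) * norm a" using K [of a] L [of a] by (simp add: algebra_simps)
    finally show ?thesis .
  qed
  then show thesis by (rule that)
qed

lemma toeplitz_op_shift: "toeplitz_op A (ell2_shift a) = ell2_shift (toeplitz_op A a)"
  by (simp add: toeplitz_op_def shift_simps shift_map A bounded_clinear_cadjoint)

lemma toeplitz_op_monom:
  "toeplitz_op A (ell2_monom k x) = ell2_monom k (A x) + ell2_shift (ell2_monom k (cadjoint A x))"
  by (simp add: toeplitz_op_def map_monom A bounded_clinear_cadjoint)

text \<open>On the unit circle, \<open>(A + A\<^sup>* z)\<^sup>* = A\<^sup>* + A z\<inverse> = z\<inverse> (A + A\<^sup>* z)\<close>. This self-adjointness up to a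
shift is what characterises the symbols of this form.\<close>

lemma cinner_toeplitz_shift: "cinner (toeplitz_op A a) (ell2_shift b) = cinner a (toeplitz_op A b)"
proof -
  have "cinner (ell2_map (cadjoint A) a) b = cinner a (ell2_map A b)"
    by (metis A cinner_commute cinner_map)
  moreover have "cinner (ell2_map A a) (ell2_shift b) = cinner a (ell2_shift (ell2_map (cadjoint A) b))"
    by (simp only: cinner_map [OF A] shift_map [OF bounded_clinear_cadjoint [OF A]])
  ultimately show ?thesis
    by (simp add: toeplitz_op_def cinner_add_left cinner_add_right shift_simps(3))
qed

end

text \<open>An invariant range makes the operator \<open>X\<close> with \<open>toeplitz_op A \<circ> V = V \<circ> X\<close> well defined. It inherits from
\<open>toeplitz_op A\<close> that it commutes with the shift and is self-adjoint up to a shift. The latter identifies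
the coefficients of the image of a constant: pairing the coefficient of index \<open>n + 1\<close> with \<open>y\<close> moves \<open>X\<close> onto
\<open>z\<^sup>n y\<close>, whose image has no constant coefficient once \<open>n \<ge> 1\<close>.\<close>

lemma toeplitz_op_compression:
  fixes V :: "'e::complex_hilbert ell2 \<Rightarrow> 'g::complex_hilbert ell2"
  assumes A: "bounded_clinear A" and V: "cisometry V"
    and shift: "\<And>a. V (ell2_shift a) = ell2_shift (V a)"
    and inv: "\<And>a. toeplitz_op A (V a) \<in> range V"
  obtains B where "bounded_clinear B"
    and "\<And>x. toeplitz_op A (V (ell2_monom 0 x)) = V (toeplitz_op B (ell2_monom 0 x))"
proof -
  have "\<exists>b. toeplitz_op A (V a) = V b" for a using inv [of a] by blast
  then obtain X where X: "\<And>a. toeplitz_op A (V a) = V (X a)" by metis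
  note V_inj = cisometry_inj [OF V] and V_cinner = cisometry_cinner [OF V]
  have V_lin: "V (a + b) = V a + V b" "V (c *\<^sub>C a) = c *\<^sub>C V a" for a b c
    using V bounded_clinearD unfolding cisometry_def by blast+
  have V_norm: "norm (V a) = norm a" for a using V by (simp add: cisometry_def)
  have X_add: "X (a + b) = X a + X b" for a b
    by (simp add: V_inj [symmetric] V_lin X [symmetric] toeplitz_op_add [OF A])
  have X_scaleC: "X (c *\<^sub>C a) = c *\<^sub>C X a" for a c
    by (simp add: V_inj [symmetric] V_lin X [symmetric] toeplitz_op_scaleC [OF A])
  have X_shift: "X (ell2_shift a) = ell2_shift (X a)" for a
    by (simp add: V_inj [symmetric] shift X [symmetric] toeplitz_op_shift [OF A])
  have X_adj: "cinner (X a) (ell2_shift b) = cinner a (X b)" for a b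
    by (simp add: V_cinner [symmetric] shift X [symmetric] cinner_toeplitz_shift [OF A])
  obtain K where K: "\<And>a. norm (X a) \<le> K * norm a"
    using toeplitz_op_bounded [OF A] by (metis V_norm X)
  define B where "B x = ell2_coeff (X (ell2_monom 0 x)) 0" for x
  have B: "bounded_clinear B"
  proof (rule bounded_clinearI)
    show "norm (B x) \<le> K * norm x" for x
      using norm_coeff_le [of "X (ell2_monom 0 x)" 0] K [of "ell2_monom 0 x"] by (simp add: B_def)
  qed (simp_all add: B_def ell2_monom_add ell2_monom_scaleC X_add X_scaleC)
  have coeff_Suc: "cinner (ell2_coeff (X (ell2_monom 0 x)) (Suc n)) y =
      cinner x (ell2_coeff (X (ell2_monom n y)) 0)" for x y n
    by (metis X_adj cinner_monom cinner_monom_left shift_monom)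
  have coeff_1: "ell2_coeff (X (ell2_monom 0 x)) (Suc 0) = cadjoint B x" for x
    by (rule cinner_ext) (simp add: coeff_Suc cinner_cadjoint_left [OF B] B_def)
  have coeff_ge_2: "ell2_coeff (X (ell2_monom 0 x)) (Suc (Suc n)) = 0" for x n
    by (rule cinner_ext)
      (simp add: coeff_Suc shift_monom [symmetric] X_shift cinner.zero_left cinner.zero_right)
  have "X (ell2_monom 0 x) = toeplitz_op B (ell2_monom 0 x)" for x
  proof (rule ell2_eqI)
    fix n
    consider "n = 0" | "n = Suc 0" | m where "n = Suc (Suc m)" by (metis not0_implies_Suc)
    then show "ell2_coeff (X (ell2_monom 0 x)) n = ell2_coeff (toeplitz_op B (ell2_monom 0 x)) n"
      by cases (simp_all add: toeplitz_op_monom [OF B] coeff_1 coeff_ge_2 B_def [symmetric])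
  qed
  then show thesis using that [OF B] X by simp
qed

text \<open>The constants are the orthogonal complement of the range of the shift. An isometry commuting with the
shift carries them onto the orthogonal complement of the shifted range, which depends on
the range alone.\<close>

lemma wandering_subspace_monom:
  fixes V :: "'e::complex_inner ell2 \<Rightarrow> 'g::complex_inner ell2"
    and V' :: "'f::complex_inner ell2 \<Rightarrow> 'g ell2"
  assumes V: "cisometry V" and shift: "\<And>a. V (ell2_shift a) = ell2_shift (V a)"
    and V': "cisometry V'" and shift': "\<And>a. V' (ell2_shift a) = ell2_shift (V' a)"
    and range: "range V' = range V"
  shows "\<exists>y. V (ell2_monom 0 x) = V' (ell2_monom 0 y)"
proof -
  obtain b where b: "V (ell2_monom 0 x) = V' b" using range by (metis imageE rangeI)
  have "ell2_coeff b (Suc n) = 0" for n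
  proof (rule cinner_ext)
    fix y
    obtain a where a: "V' (ell2_monom n y) = V a" using range by (metis imageE rangeI)
    have "cinner (ell2_coeff b (Suc n)) y = cinner (V' b) (V' (ell2_shift (ell2_monom n y)))"
      by (simp add: cisometry_cinner [OF V'] shift_monom cinner_monom)
    also have "\<dots> = cinner (V (ell2_monom 0 x)) (V (ell2_shift a))"
      by (simp add: b shift shift' a)
    also have "\<dots> = cinner 0 y"
      by (simp add: cisometry_cinner [OF V] cinner_monom_left cinner.zero_left cinner.zero_right)
    finally show "cinner (ell2_coeff b (Suc n)) y = cinner 0 y" .
  qed
  then have "b = ell2_monom 0 (ell2_coeff b 0)"
    by (intro ell2_eqI) (metis coeff_monom not0_implies_Suc)
  with b show ?thesis by metis
qed

lemma wandering_subspace_unitary: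
  fixes V :: "'e::complex_inner ell2 \<Rightarrow> 'g::complex_inner ell2"
    and V' :: "'f::complex_inner ell2 \<Rightarrow> 'g ell2"
  assumes V: "cisometry V" and shift: "\<And>a. V (ell2_shift a) = ell2_shift (V a)"
    and V': "cisometry V'" and shift': "\<And>a. V' (ell2_shift a) = ell2_shift (V' a)"
    and range: "range V' = range V"
  obtains U where "unitary_op U" and "\<And>x. V (ell2_monom 0 x) = V' (ell2_monom 0 (U x))"
proof -
  obtain U where U: "\<And>x. V (ell2_monom 0 x) = V' (ell2_monom 0 (U x))"
    using wandering_subspace_monom [OF V shift V' shift' range] by metis
  obtain W where W: "\<And>y. V' (ell2_monom 0 y) = V (ell2_monom 0 (W y))"
    using wandering_subspace_monom [OF V' shift' V shift range [symmetric]] by metis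
  have inj: "x = y" if "V' (ell2_monom 0 x) = V' (ell2_monom 0 y)" for x y
    using that cisometry_inj [OF V'] by (metis coeff_monom)
  have lin: "V (a + b) = V a + V b" "V (c *\<^sub>C a) = c *\<^sub>C V a" for a b c
    using V bounded_clinearD unfolding cisometry_def by blast+
  have lin': "V' (a + b) = V' a + V' b" "V' (c *\<^sub>C a) = c *\<^sub>C V' a" for a b c
    using V' bounded_clinearD unfolding cisometry_def by blast+
  have norm: "norm (U x) = norm x" for x
    using U [of x] V V' unfolding cisometry_def by (metis norm_monom)
  have "bounded_clinear U"
  proof (rule bounded_clinearI [where K = 1])
    show "U (x + y) = U x + U y" for x y
      by (rule inj) (simp add: U [symmetric] lin lin' ell2_monom_add)
    show "U (c *\<^sub>C x) = c *\<^sub>C U x" for c x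
      by (rule inj) (simp add: U [symmetric] lin lin' ell2_monom_scaleC)
  qed (simp add: norm)
  moreover have "surj U"
  proof (rule surjI)
    show "U (W y) = y" for y by (rule inj) (simp only: U [symmetric] W [symmetric])
  qed
  ultimately have "unitary_op U" by (simp add: unitary_op_def cisometry_def norm)
  with U show thesis by (rule that [rotated])
qed

section \<open>Invariance and intertwining\<close>

context
  fixes \<Theta> :: "complex \<Rightarrow> 'e::complex_hilbert \<Rightarrow> 'g::complex_hilbert"
    and V :: "'e ell2 \<Rightarrow> 'g ell2"
  assumes V: "has_symbol V \<Theta>"
begin

lemma mult_op_hardy_fun: "mult_op \<Theta> (hardy_fun a) = hardy_fun (V a)"
  using V by (auto simp: mult_op_def has_symbol_def restrict_def hardy_fun_def)

lemma mult_op_image_hardy2: "mult_op \<Theta> ` hardy2 = hardy_fun ` range V"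
  by (simp add: hardy2_eq_range image_image mult_op_hardy_fun)

text \<open>A constant function takes each value \<open>x\<close> at every point of the disc, so testing on constants already
captures the pointwise relation.\<close>

lemma intertwines_iff:
  assumes A: "bounded_clinear A" and B: "bounded_clinear B"
  shows "intertwines \<Theta> A B \<longleftrightarrow> (\<forall>a. toeplitz_op A (V a) = V (toeplitz_op B a))"
    and "intertwines \<Theta> A B \<longleftrightarrow>
      (\<forall>x. toeplitz_op A (V (ell2_monom 0 x)) = V (toeplitz_op B (ell2_monom 0 x)))"
proof -
  let ?I = "intertwines \<Theta> A B" and ?all = "\<forall>a. toeplitz_op A (V a) = V (toeplitz_op B a)"
    and ?const = "\<forall>x. toeplitz_op A (V (ell2_monom 0 x)) = V (toeplitz_op B (ell2_monom 0 x))"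
  have eval: "hardy_fun (toeplitz_op A (V a)) z = (toeplitz_symbol A z \<circ> \<Theta> z) (hardy_fun a z)"
    "hardy_fun (V (toeplitz_op B a)) z = (\<Theta> z \<circ> toeplitz_symbol B z) (hardy_fun a z)"
    if "z \<in> unit_disc" for a z
    using that V has_symbol_toeplitz [OF A] has_symbol_toeplitz [OF B] by (simp_all add: has_symbol_def)
  have "?I \<Longrightarrow> ?all"
    by (intro allI hardy_fun_eqI) (simp only: eval intertwines_def)
  moreover have "?const \<Longrightarrow> ?I"
    unfolding intertwines_def
  proof (intro ballI ext)
    fix z and x :: 'e assume const: "?const" and z: "z \<in> unit_disc"
    have "hardy_fun (ell2_monom 0 x) z = x" using hardy_fun_monom [OF z, of 0 x] by simp
    with eval [OF z, of "ell2_monom 0 x"] const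
    show "(toeplitz_symbol A z \<circ> \<Theta> z) x = (\<Theta> z \<circ> toeplitz_symbol B z) x" by simp
  qed
  ultimately show "?I \<longleftrightarrow> ?all" and "?I \<longleftrightarrow> ?const" by blast+
qed

end

lemma inj_hardy_fun: "inj hardy_fun"
  by (rule injI) (metis hardy_fun_eqI)

lemma mult_op_toeplitz_image:
  assumes "bounded_clinear A"
  shows "mult_op (toeplitz_symbol A) ` (hardy_fun ` S) = hardy_fun ` (toeplitz_op A ` S)"
  by (simp add: image_image mult_op_hardy_fun [OF has_symbol_toeplitz [OF assms]])

text \<open>With \<open>\<Theta> = \<Theta>' U\<close>, transporting the intertwining relation for \<open>\<Theta>\<close> to \<open>\<Theta>'\<close> gives
\<open>U (B + B\<^sup>* z) = (B' + B'\<^sup>* z) U\<close> on constants, and the constant coefficient is \<open>U B = B' U\<close>.\<close>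

lemma intertwining_unitarily_equivalent:
  fixes \<Theta> :: "complex \<Rightarrow> 'e::complex_hilbert \<Rightarrow> 'g::complex_hilbert"
    and \<Theta>' :: "complex \<Rightarrow> 'f::complex_hilbert \<Rightarrow> 'g"
  assumes inner: "inner_function \<Theta>" "inner_function \<Theta>'"
    and range: "mult_op \<Theta>' ` hardy2 = mult_op \<Theta> ` hardy2"
    and A: "bounded_clinear A"
    and B: "bounded_clinear B" "intertwines \<Theta> A B"
    and B': "bounded_clinear B'" "intertwines \<Theta>' A B'"
  shows "unitarily_equivalent B B'"
proof -
  obtain V where V: "cisometry V" "\<And>a. V (ell2_shift a) = ell2_shift (V a)"
    "has_symbol V \<Theta>"
    using inner_function_isometry [OF inner(1)] by metis
  obtain V' where V': "cisometry V'" "\<And>a. V' (ell2_shift a) = ell2_shift (V' a)"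
    "has_symbol V' \<Theta>'"
    using inner_function_isometry [OF inner(2)] by metis
  have "range V' = range V"
    using range
    by (simp add: inj_image_eq_iff [OF inj_hardy_fun] mult_op_image_hardy2 [OF V(3)]
        mult_op_image_hardy2 [OF V'(3)])
  then obtain U where U: "unitary_op U" "\<And>x. V (ell2_monom 0 x) = V' (ell2_monom 0 (U x))"
    using wandering_subspace_unitary [OF V(1,2) V'(1,2)] by metis
  have lin: "V (a + b) = V a + V b" for a b
    using V(1) bounded_clinearD(2) unfolding cisometry_def by blast
  have lin': "V' (a + b) = V' a + V' b" for a b
    using V'(1) bounded_clinearD(2) unfolding cisometry_def by blast
  have "U (B x) = B' (U x)" for x
  proof -
    have "V' (ell2_monom 0 (U (B x)) + ell2_shift (ell2_monom 0 (U (cadjoint B x)))) =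
        V (toeplitz_op B (ell2_monom 0 x))"
      by (simp add: toeplitz_op_monom [OF B(1)] lin lin' V(2) V'(2) U(2))
    also have "\<dots> = toeplitz_op A (V (ell2_monom 0 x))"
      using B intertwines_iff(1) [OF V(3) A B(1)] by simp
    also have "\<dots> = toeplitz_op A (V' (ell2_monom 0 (U x)))" by (simp add: U(2))
    also have "\<dots> = V' (toeplitz_op B' (ell2_monom 0 (U x)))"
      using B' intertwines_iff(1) [OF V'(3) A B'(1)] by simp
    finally have "ell2_coeff (ell2_monom 0 (U (B x)) + ell2_shift (ell2_monom 0 (U (cadjoint B x)))) 0 =
        ell2_coeff (toeplitz_op B' (ell2_monom 0 (U x))) 0"
      by (simp add: cisometry_inj [OF V'(1)])
    then show ?thesis by (simp add: toeplitz_op_monom [OF B'(1)])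
  qed
  with U(1) show ?thesis unfolding unitarily_equivalent_def by (intro exI [of _ U]) auto
qed

theorem theorem3p4:
  fixes \<Theta> :: "complex \<Rightarrow> 'e::complex_hilbert \<Rightarrow> 'g::complex_hilbert"
    and A :: "'g \<Rightarrow> 'g"
  assumes "inner_function \<Theta>"
    and "bounded_clinear A"
  shows "mult_op \<Theta> ` hardy2 \<subseteq> hardy2 \<and>
    (mult_op (toeplitz_symbol A) ` (mult_op \<Theta> ` hardy2) \<subseteq> mult_op \<Theta> ` hardy2
      \<longleftrightarrow> (\<exists>B. bounded_clinear B \<and> intertwines \<Theta> A B)) \<and>
    (\<forall>B B'. bounded_clinear B \<and> intertwines \<Theta> A B \<and>
        bounded_clinear B' \<and> intertwines \<Theta> A B' \<longrightarrow> B = B') \<and>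
    (\<forall>(\<Theta>' :: complex \<Rightarrow> 'f::complex_hilbert \<Rightarrow> 'g) B B'.
        inner_function \<Theta>' \<and> mult_op \<Theta>' ` hardy2 = mult_op \<Theta> ` hardy2 \<and>
        bounded_clinear B \<and> intertwines \<Theta> A B \<and>
        bounded_clinear B' \<and> intertwines \<Theta>' A B' \<longrightarrow> unitarily_equivalent B B')"
proof (intro conjI allI impI)
  note A = assms(2)
  obtain V where V: "cisometry V" "\<And>a. V (ell2_shift a) = ell2_shift (V a)"
    "has_symbol V \<Theta>"
    using inner_function_isometry [OF assms(1)] by metis
  note image = mult_op_image_hardy2 [OF V(3)]
  show "mult_op \<Theta> ` hardy2 \<subseteq> hardy2" unfolding image by (auto simp: hardy2_eq_range)
  have "mult_op (toeplitz_symbol A) ` (mult_op \<Theta> ` hardy2) \<subseteq> mult_op \<Theta> ` hardy2 \<longleftrightarrow>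
      toeplitz_op A ` range V \<subseteq> range V"
    unfolding image mult_op_toeplitz_image [OF A] by (rule inj_image_subset_iff [OF inj_hardy_fun])
  also have "\<dots> \<longleftrightarrow> (\<exists>B. bounded_clinear B \<and> intertwines \<Theta> A B)"
  proof
    assume "toeplitz_op A ` range V \<subseteq> range V"
    then have "toeplitz_op A (V a) \<in> range V" for a by blast
    then obtain B where "bounded_clinear B"
      "\<And>x. toeplitz_op A (V (ell2_monom 0 x)) = V (toeplitz_op B (ell2_monom 0 x))"
      using toeplitz_op_compression [OF A V(1,2)] by metis
    then show "\<exists>B. bounded_clinear B \<and> intertwines \<Theta> A B"
      using intertwines_iff(2) [OF V(3) A] by blast
  next
    assume "\<exists>B. bounded_clinear B \<and> intertwines \<Theta> A B"
    then obtain B where "\<And>a. toeplitz_op A (V a) = V (toeplitz_op B a)"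
      using intertwines_iff(1) [OF V(3) A] by blast
    then show "toeplitz_op A ` range V \<subseteq> range V" by auto
  qed
  finally show "mult_op (toeplitz_symbol A) ` (mult_op \<Theta> ` hardy2) \<subseteq> mult_op \<Theta> ` hardy2
      \<longleftrightarrow> (\<exists>B. bounded_clinear B \<and> intertwines \<Theta> A B)" .
  show "B = B'" if "bounded_clinear B \<and> intertwines \<Theta> A B \<and>
      bounded_clinear B' \<and> intertwines \<Theta> A B'" for B B'
  proof
    fix x
    have "V (toeplitz_op B (ell2_monom 0 x)) = V (toeplitz_op B' (ell2_monom 0 x))"
      using that intertwines_iff(1) [OF V(3) A] by metis
    then have "ell2_coeff (toeplitz_op B (ell2_monom 0 x)) 0 =
        ell2_coeff (toeplitz_op B' (ell2_monom 0 x)) 0"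
      by (simp add: cisometry_inj [OF V(1)])
    then show "B x = B' x" using that by (simp add: toeplitz_op_monom)
  qed
  show "unitarily_equivalent B B'"
    if "inner_function \<Theta>' \<and> mult_op \<Theta>' ` hardy2 = mult_op \<Theta> ` hardy2 \<and>
        bounded_clinear B \<and> intertwines \<Theta> A B \<and>
        bounded_clinear B' \<and> intertwines \<Theta>' A B'"
    for \<Theta>' :: "complex \<Rightarrow> 'f \<Rightarrow> 'g" and B B'
    using that intertwining_unitarily_equivalent [OF assms(1) _ _ A] by blast
qed

end
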